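(* Let $R$ be a division ring, $q\geq1$, and let $M$ be an infinite right $M_q(R)$-module. Then the monoid $\overline{\mathcal X}^*(M_{M_q(R)})$ of non-trivial colours is isomorphic to $q\mathbb N$, and hence to $(\mathbb N,+)$.
   Context: For a unital ring $T$, a right $T$-module $M$ is a structure in the language $L_T=\langle +,-,0,\{\cdot_t:t\in T\}\rangle$ ($\cdot_t$ = right multiplication by $t$). A positive primitive (pp) formula is one of the form $\exists \bar y\,\bigwedge_j(\text{linear equation in }\bar x,\bar y)$; a subset of some $M^n$ is pp-definable if it is defined by a pp-formula with parameters from $M$, and a pp-definable bijection is a bijection between such sets whose graph is pp-definable. $\overline{\mathcal X}^*(M_T)$ is the set of equivalence classes of non-empty pp-definable subsets of finite powers of $M$ under the relation "there is a pp-definable bijection between them", made into a commutative monoid under the operation induced by Cartesian product. $q\mathbb N=\{0,q,2q,\dots\}$ under addition. *)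

theory Defs
  imports "Jordan_Normal_Form.Matrix"
begin

text \<open>
  The underlying abelian group of a module is the whole type \<open>'m\<close>; \<open>x \<star> t\<close> is right
  multiplication by the scalar \<open>t\<close>, meaningful only for \<open>t\<close> in the carrier of \<open>T\<close>.
\<close>

locale right_module = T?: ring T
  for T :: "('t, 'b) ring_scheme" (structure)
    and act :: "'m :: ab_group_add \<Rightarrow> 't \<Rightarrow> 'm" (infixl \<open>\<star>\<close> 70) +
  assumes act_add_left: "t \<in> carrier T \<Longrightarrow> (x + y) \<star> t = x \<star> t + y \<star> t"
    and act_add_right: "s \<in> carrier T \<Longrightarrow> t \<in> carrier T \<Longrightarrow> x \<star> (s \<oplus> t) = x \<star> s + x \<star> t"
    and act_mult: "s \<in> carrier T \<Longrightarrow> t \<in> carrier T \<Longrightarrow> x \<star> (s \<otimes> t) = (x \<star> s) \<star> t"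
    and act_one: "x \<star> \<one> = x"

text \<open>
  A positive primitive formula \<open>\<exists>y\<^sub>1 \<dots> y\<^sub>k. \<And>\<^sub>j (linear equation)\<close> is stored as the number \<open>k\<close> of
  bound variables and one coefficient list per equation. A coefficient list \<open>[c\<^sub>0, c\<^sub>1, \<dots>]\<close> stands
  for \<open>v\<^sub>0\<cdot>c\<^sub>0 + v\<^sub>1\<cdot>c\<^sub>1 + \<dots> = 0\<close>, where \<open>v\<close> lists the free variables followed by the bound ones.
\<close>

datatype 't pp_formula = PP (bound_vars: nat) (equations: "'t list list")

definition pp_formula_in :: "('t, 'b) ring_scheme \<Rightarrow> nat \<Rightarrow> 't pp_formula \<Rightarrow> bool" where
  "pp_formula_in T n \<phi> \<longleftrightarrow>
     (\<forall>c \<in> set (equations \<phi>). length c = n + bound_vars \<phi> \<and> set c \<subseteq> carrier T)"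

definition lin_comb :: "('m :: ab_group_add \<Rightarrow> 't \<Rightarrow> 'm) \<Rightarrow> 'm list \<Rightarrow> 't list \<Rightarrow> 'm" where
  "lin_comb act v c = (\<Sum>i<length v. act (v ! i) (c ! i))"

definition tuples :: "nat \<Rightarrow> 'm list set" where
  "tuples n = {xs. length xs = n}"

definition pp_holds :: "('m :: ab_group_add \<Rightarrow> 't \<Rightarrow> 'm) \<Rightarrow> 't pp_formula \<Rightarrow> 'm list \<Rightarrow> bool" where
  "pp_holds act \<phi> xs \<longleftrightarrow>
     (\<exists>ys \<in> tuples (bound_vars \<phi>). \<forall>c \<in> set (equations \<phi>). lin_comb act (xs @ ys) c = 0)"

text \<open>The tuple \<open>ps\<close> consists of the parameters, substituted for the last \<open>m\<close> free variables.\<close>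

definition pp_definable ::
  "('t, 'b) ring_scheme \<Rightarrow> ('m :: ab_group_add \<Rightarrow> 't \<Rightarrow> 'm) \<Rightarrow> nat \<Rightarrow> 'm list set \<Rightarrow> bool" where
  "pp_definable T act n X \<longleftrightarrow>
     (\<exists>m \<phi>. \<exists>ps \<in> tuples m. pp_formula_in T (n + m) \<phi> \<and>
        X = {xs \<in> tuples n. pp_holds act \<phi> (xs @ ps)})"

definition pp_sets ::
  "('t, 'b) ring_scheme \<Rightarrow> ('m :: ab_group_add \<Rightarrow> 't \<Rightarrow> 'm) \<Rightarrow> 'm list set set" where
  "pp_sets T act = {X. X \<noteq> {} \<and> (\<exists>n. pp_definable T act n X)}"

text \<open>Concatenation of tuples identifies \<open>M\<^sup>n \<times> M\<^sup>m\<close> with \<open>M\<^sup>n\<^sup>+\<^sup>m\<close>.\<close>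

definition tuple_prod :: "'m list set \<Rightarrow> 'm list set \<Rightarrow> 'm list set" where
  "tuple_prod X Y = {xs @ ys | xs ys. xs \<in> X \<and> ys \<in> Y}"

definition pp_bijection ::
  "('t, 'b) ring_scheme \<Rightarrow> ('m :: ab_group_add \<Rightarrow> 't \<Rightarrow> 'm) \<Rightarrow>
     'm list set \<Rightarrow> 'm list set \<Rightarrow> ('m list \<Rightarrow> 'm list) \<Rightarrow> bool" where
  "pp_bijection T act X Y f \<longleftrightarrow>
     bij_betw f X Y \<and>
     (\<exists>n m. pp_definable T act n X \<and> pp_definable T act m Y \<and>
        pp_definable T act (n + m) {xs @ f xs | xs. xs \<in> X})"

definition colour_rel ::
  "('t, 'b) ring_scheme \<Rightarrow> ('m :: ab_group_add \<Rightarrow> 't \<Rightarrow> 'm) \<Rightarrow> ('m list set \<times> 'm list set) set" where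
  "colour_rel T act =
     {(X, Y). X \<in> pp_sets T act \<and> Y \<in> pp_sets T act \<and> (\<exists>f. pp_bijection T act X Y f)}"

text \<open>
  The product of two classes is the class of \<open>X \<times> Y\<close> for any representatives \<open>X\<close> and \<open>Y\<close>. The
  unit is the class of the one-point set \<open>M\<^sup>0\<close>, which is the class of all singletons.
\<close>

definition colour_monoid ::
  "('t, 'b) ring_scheme \<Rightarrow> ('m :: ab_group_add \<Rightarrow> 't \<Rightarrow> 'm) \<Rightarrow> 'm list set set monoid" where
  "colour_monoid T act =
     \<lparr>carrier = pp_sets T act // colour_rel T act,
      mult = (\<lambda>A B. colour_rel T act `` {tuple_prod X Y | X Y. X \<in> A \<and> Y \<in> B}),
      one = colour_rel T act `` {tuples 0}\<rparr>"

definition multiples_monoid :: "nat \<Rightarrow> nat monoid" where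
  "multiples_monoid q = \<lparr>carrier = {q * k | k. True}, mult = (+), one = 0\<rparr>"

definition nat_add_monoid :: "nat monoid" where
  "nat_add_monoid = \<lparr>carrier = UNIV, mult = (+), one = 0\<rparr>"

end

theory Submission
  imports Defs
begin

text \<open>
  Let \<open>E\<^sub>i\<^sub>j\<close> be the matrix units, with indices from \<open>0\<close>. The group \<open>V = M\<cdot>E\<^sub>0\<^sub>0\<close> is a right vector
  space over \<open>R\<close> and \<open>M \<cong> V\<^sup>q\<close>, so an equation over \<open>M\<^sub>q(R)\<close> is a system of \<open>q\<close> linear equations
  over \<open>R\<close>. Gaussian elimination puts such a system into solved form, and solved forms are closed
  under projection, so the non-empty pp-definable sets are exactly the sets on which some of the
  \<open>V\<close>-coordinates are free and the others are affine functions of them. By the exchange argument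
  the number of free coordinates depends only on the set. It is preserved by pp-definable
  bijections, because it can be read off the graph through either projection; conversely, matching
  free coordinates gives a pp-definable bijection between sets of equal dimension. Dimension is
  additive on products and takes every value, since \<open>V\<^sup>d \<subseteq> M\<^sup>d\<close> has dimension \<open>d\<close>.
\<close>

section \<open>Affine sets over a division ring\<close>

lemma restrict_eqD: "restrict f A = restrict g A \<Longrightarrow> x \<in> A \<Longrightarrow> f x = g x"
  by (metis restrict_apply')

text \<open>
  The scalar \<open>1\<close> need not act as the identity: for a module over \<open>M\<^sub>q(R)\<close>, the corner \<open>R\<close> acts on
  the whole module, and \<open>V\<close>, the fixed points of \<open>1\<close>, is the vector space inside it.
\<close>

locale nonunital_right_space =
  fixes sc :: "'m :: ab_group_add \<Rightarrow> 'r :: division_ring \<Rightarrow> 'm" (infixl \<open>\<cdot>\<close> 70)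
  assumes sc_add_left: "(x + y) \<cdot> r = x \<cdot> r + y \<cdot> r"
    and sc_add_right: "x \<cdot> (r + s) = x \<cdot> r + x \<cdot> s"
    and sc_mult: "x \<cdot> (r * s) = x \<cdot> r \<cdot> s"
begin

section \<open>The scalar action and the space \<open>V\<close> fixed by its unit\<close>

definition V :: "'m set" where
  "V = {v. v \<cdot> 1 = v}"

lemma sc_zero_left [simp]: "0 \<cdot> r = 0"
  using sc_add_left[of 0 0 r] by simp

lemma sc_zero_right [simp]: "x \<cdot> 0 = 0"
  using sc_add_right[of x 0 0] by simp

lemma sc_minus_left: "(- x) \<cdot> r = - (x \<cdot> r)"
  using sc_add_left[of x "- x" r] by (simp add: eq_neg_iff_add_eq_0 add.commute)

lemma sc_minus_right: "x \<cdot> (- r) = - (x \<cdot> r)"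
  using sc_add_right[of x r "- r"] by (simp add: eq_neg_iff_add_eq_0 add.commute)

lemma sc_diff_left: "(x - y) \<cdot> r = x \<cdot> r - y \<cdot> r"
  using sc_add_left[of x "- y" r] by (simp add: sc_minus_left)

lemma sc_sum_left: "(\<Sum>i\<in>I. f i) \<cdot> r = (\<Sum>i\<in>I. f i \<cdot> r)"
  by (induction I rule: infinite_finite_induct) (auto simp: sc_add_left)

lemma sc_sum_right: "x \<cdot> (\<Sum>i\<in>I. f i) = (\<Sum>i\<in>I. x \<cdot> f i)"
  by (induction I rule: infinite_finite_induct) (auto simp: sc_add_right)

lemma sc_one: "v \<in> V \<Longrightarrow> v \<cdot> 1 = v"
  by (simp add: V_def)

lemma zero_in_V [simp]: "0 \<in> V"
  by (simp add: V_def)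

lemma add_in_V [simp]: "u \<in> V \<Longrightarrow> v \<in> V \<Longrightarrow> u + v \<in> V"
  by (simp add: V_def sc_add_left)

lemma minus_in_V [simp]: "u \<in> V \<Longrightarrow> - u \<in> V"
  by (simp add: V_def sc_minus_left)

lemma diff_in_V [simp]: "u \<in> V \<Longrightarrow> v \<in> V \<Longrightarrow> u - v \<in> V"
  by (simp add: V_def sc_diff_left)

text \<open>Since \<open>r * 1 = r\<close>, acting by \<open>1\<close> after \<open>r\<close>
  changes nothing; thus \<open>V\<close> is also the image of the action.\<close>

lemma sc_in_V [simp]: "x \<cdot> r \<in> V"
  by (simp add: V_def flip: sc_mult)

lemma sum_in_V [simp]: "(\<And>i. i \<in> I \<Longrightarrow> f i \<in> V) \<Longrightarrow> (\<Sum>i\<in>I. f i) \<in> V"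
  by (induction I rule: infinite_finite_induct) auto

section \<open>Solved forms and their free coordinates\<close>

text \<open>
  Solution sets of linear systems in solved form: the coordinates in \<open>I\<close> are free and those in
  \<open>S - I\<close> are affine functions of them.
\<close>

definition solved ::
    "'i set \<Rightarrow> 'i set \<Rightarrow> ('i \<Rightarrow> 'i \<Rightarrow> 'r) \<Rightarrow> ('i \<Rightarrow> 'm) \<Rightarrow> ('i \<Rightarrow> 'm) set" where
  "solved S I A b = {x \<in> S \<rightarrow>\<^sub>E V. \<forall>j\<in>S - I. x j = (\<Sum>i\<in>I. x i \<cdot> A i j) + b j}"

text \<open>The set \<open>I\<close> is kept explicit because its cardinality will be the dimension.
  As \<open>b\<close> takes values in \<open>V\<close>, every \<open>V\<close>-valued family on
  \<open>I\<close> extends to a point.\<close>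

definition affine_on :: "'i set \<Rightarrow> 'i set \<Rightarrow> ('i \<Rightarrow> 'm) set \<Rightarrow> bool" where
  "affine_on S I X \<longleftrightarrow> finite S \<and> I \<subseteq> S \<and> (\<exists>A b. b \<in> S \<rightarrow> V \<and> X = solved S I A b)"

lemma affine_on_finite: "affine_on S I X \<Longrightarrow> finite I"
  by (auto simp: affine_on_def intro: finite_subset)

lemma affine_on_solved:
  "finite S \<Longrightarrow> I \<subseteq> S \<Longrightarrow> b \<in> S \<rightarrow> V \<Longrightarrow> affine_on S I (solved S I A b)"
  by (auto simp: affine_on_def)

lemma affine_on_all: "finite S \<Longrightarrow> affine_on S S (S \<rightarrow>\<^sub>E V)"
  using affine_on_solved[of S S "\<lambda>_. 0" "\<lambda>_ _. 0"] by (simp add: solved_def)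

text \<open>The equations compute a point from its values on \<open>I\<close>, and any values in
  \<open>V\<close> are possible there because the right-hand sides stay in \<open>V\<close>.\<close>

lemma solved_bij_betw:
  assumes "I \<subseteq> S" and b: "b \<in> S \<rightarrow> V"
  shows "bij_betw (\<lambda>x. restrict x I) (solved S I A b) (I \<rightarrow>\<^sub>E V)"
proof (rule bij_betwI')
  fix x y assume x: "x \<in> solved S I A b" and y: "y \<in> solved S I A b"
  show "(restrict x I = restrict y I) = (x = y)"
  proof
    assume "restrict x I = restrict y I"
    then have eq: "x i = y i" if "i \<in> I" for i
      using that by (rule restrict_eqD)
    show "x = y"
    proof (rule PiE_ext[of x S "\<lambda>_. V" y])
      fix j assume "j \<in> S"
      moreover have "(\<Sum>i\<in>I. x i \<cdot> A i j) = (\<Sum>i\<in>I. y i \<cdot> A i j)"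
        using eq by (intro sum.cong) auto
      ultimately show "x j = y j"
        using x y eq by (cases "j \<in> I") (auto simp: solved_def)
    qed (use x y in \<open>auto simp: solved_def\<close>)
  qed simp
next
  fix x assume "x \<in> solved S I A b"
  then show "restrict x I \<in> I \<rightarrow>\<^sub>E V"
    using \<open>I \<subseteq> S\<close> by (auto simp: solved_def)
next
  fix y assume y: "y \<in> I \<rightarrow>\<^sub>E V"
  define x where "x = (\<lambda>j\<in>S. if j \<in> I then y j else (\<Sum>i\<in>I. y i \<cdot> A i j) + b j)"
  have eq: "x i = y i" if "i \<in> I" for i
    using that \<open>I \<subseteq> S\<close> by (auto simp: x_def)
  have "x \<in> solved S I A b"
    using y b eq by (auto simp: solved_def x_def PiE_iff intro!: sum.cong add_in_V sum_in_V)
  moreover have "y = restrict x I"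
    using y eq by (metis PiE_restrict restrict_ext)
  ultimately show "\<exists>x\<in>solved S I A b. y = restrict x I" by blast
qed

lemma affine_on_bij_betw:
  "affine_on S I X \<Longrightarrow> bij_betw (\<lambda>x. restrict x I) X (I \<rightarrow>\<^sub>E V)"
  using solved_bij_betw by (auto simp: affine_on_def)

section \<open>Gaussian elimination on solved forms\<close>

text \<open>Coefficients act from the right, so \<open>c i0\<close> is cancelled by its inverse on
  the right. Membership in \<open>V\<close> lets the resulting scalar \<open>1\<close> act as the
  identity.\<close>

lemma linear_eq_solve:
  assumes "finite I" "i0 \<in> I" "x i0 \<in> V" "e \<in> V" "c i0 \<noteq> 0"
  shows "(\<Sum>i\<in>I. x i \<cdot> c i) = e \<longleftrightarrow>
    x i0 = (\<Sum>i\<in>I - {i0}. x i \<cdot> (- (c i * inverse (c i0)))) + e \<cdot> inverse (c i0)"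
    (is "?l \<longleftrightarrow> ?r")
proof -
  let ?d = "inverse (c i0)" and ?s = "\<Sum>i\<in>I - {i0}. x i \<cdot> c i"
  have s: "(\<Sum>i\<in>I. x i \<cdot> c i) = x i0 \<cdot> c i0 + ?s"
    using assms by (simp add: sum.remove)
  have t: "(\<Sum>i\<in>I - {i0}. x i \<cdot> (- (c i * ?d))) + e \<cdot> ?d = (e - ?s) \<cdot> ?d"
    by (simp add: sc_minus_right sc_mult sum_negf sc_diff_left sc_sum_left)
  have "x i0 \<cdot> c i0 = e - ?s \<longleftrightarrow> x i0 = (e - ?s) \<cdot> ?d"
  proof
    assume "x i0 \<cdot> c i0 = e - ?s"
    then have "(e - ?s) \<cdot> ?d = x i0 \<cdot> (c i0 * ?d)" by (simp add: sc_mult)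
    then show "x i0 = (e - ?s) \<cdot> ?d" using assms by (simp add: sc_one)
  next
    assume "x i0 = (e - ?s) \<cdot> ?d"
    then have "x i0 \<cdot> c i0 = (e - ?s) \<cdot> (?d * c i0)" by (simp add: sc_mult)
    then show "x i0 \<cdot> c i0 = e - ?s" using assms by (simp add: sc_one)
  qed
  then show ?thesis
    unfolding s t by (auto simp: algebra_simps eq_diff_eq)
qed

text \<open>An elimination step: the equation is solved for the pivot \<open>i0\<close>, and the
  result is substituted into the equations of the dependent coordinates.\<close>

lemma affine_on_pivot:
  assumes "finite S" "I \<subseteq> S" "b \<in> S \<rightarrow> V" "i0 \<in> I" "c i0 \<noteq> 0" "e \<in> V"
  shows "affine_on S (I - {i0}) {x \<in> solved S I A b. (\<Sum>i\<in>I. x i \<cdot> c i) = e}"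
proof -
  define d where "d = inverse (c i0)"
  \<comment> \<open>For \<open>j = i0\<close> these are the coefficients of the solved equation; for
    other \<open>j\<close> they arise from \<open>A\<close> by substituting that equation for
    \<open>x i0\<close>.\<close>
  define A' where "A' i j = (if j = i0 then - (c i * d) else - (c i * d) * A i0 j + A i j)" for i j
  define b' where "b' j = (if j = i0 then e \<cdot> d else e \<cdot> d \<cdot> A i0 j + b j)" for j
  have fin: "finite I" using assms finite_subset by blast
  have "{x \<in> solved S I A b. (\<Sum>i\<in>I. x i \<cdot> c i) = e} = solved S (I - {i0}) A' b'"
  proof (rule Set.set_eqI)
    fix x
    let ?J = "I - {i0}"
    have "x \<in> solved S I A b \<and> (\<Sum>i\<in>I. x i \<cdot> c i) = e \<longleftrightarrow> x \<in> solved S ?J A' b'"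
      if x: "x \<in> S \<rightarrow>\<^sub>E V"
    proof -
      have 1: "(\<Sum>i\<in>I. x i \<cdot> c i) = e \<longleftrightarrow> x i0 = (\<Sum>i\<in>?J. x i \<cdot> A' i i0) + b' i0"
        using linear_eq_solve[of I i0 x e c] assms fin x
        by (auto simp: A'_def b'_def d_def)
      have 2: "(\<Sum>i\<in>I. x i \<cdot> A i j) + b j = (\<Sum>i\<in>?J. x i \<cdot> A' i j) + b' j"
        if j: "j \<in> S - I" and eq: "x i0 = (\<Sum>i\<in>?J. x i \<cdot> A' i i0) + b' i0" for j
      proof -
        have "(\<Sum>i\<in>I. x i \<cdot> A i j) = x i0 \<cdot> A i0 j + (\<Sum>i\<in>?J. x i \<cdot> A i j)"
          using fin assms by (simp add: sum.remove)
        also have "x i0 \<cdot> A i0 j = (\<Sum>i\<in>?J. x i \<cdot> (- (c i * d) * A i0 j)) + e \<cdot> d \<cdot> A i0 j"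
          by (subst eq) (simp only: A'_def b'_def if_True sc_add_left sc_sum_left sc_mult simp_thms)
        finally have "(\<Sum>i\<in>I. x i \<cdot> A i j) + b j =
            (\<Sum>i\<in>?J. x i \<cdot> (- (c i * d) * A i0 j) + x i \<cdot> A i j) + (e \<cdot> d \<cdot> A i0 j + b j)"
          by (simp add: sum.distrib add_ac)
        moreover have "j \<noteq> i0" using j assms by auto
        ultimately show ?thesis
          by (simp only: A'_def b'_def sc_add_right if_False)
      qed
      have "S - ?J = insert i0 (S - I)" using assms by auto
      then show ?thesis
        using x 1 2 by (auto simp: solved_def)
    qed
    then show "x \<in> {x \<in> solved S I A b. (\<Sum>i\<in>I. x i \<cdot> c i) = e} \<longleftrightarrow> x \<in> solved S ?J A' b'"
      by (auto simp: solved_def)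
  qed
  moreover have "b' \<in> S \<rightarrow> V" using assms by (auto simp: b'_def intro!: add_in_V)
  ultimately show ?thesis using assms by (auto simp: affine_on_def)
qed

lemma affine_on_exchange:
  assumes "finite S" "I \<subseteq> S" "b \<in> S \<rightarrow> V" "i0 \<in> I" "j0 \<in> S - I" "A i0 j0 \<noteq> 0"
  shows "affine_on S (insert j0 (I - {i0})) (solved S I A b)"
proof -
  \<comment> \<open>Forget the equation for \<open>j0\<close>, so that \<open>j0\<close> becomes free, and solve it for \<open>i0\<close> instead.\<close>
  define B where "B i j = (if i = j0 then 0 else A i j)" for i j
  \<comment> \<open>This is the forgotten equation with \<open>x j0\<close> moved to the other side.
    Its coefficient at \<open>i0\<close> is \<open>A i0 j0\<close>, which is non-zero, so
    \<open>i0\<close> can serve as pivot.\<close>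
  define c where "c i = (if i = j0 then - 1 else A i j0)" for i
  have fin: "finite I" using assms finite_subset by blast
  have S: "S - I = insert j0 (S - insert j0 I)" using assms by auto
  have sB: "(\<Sum>i\<in>insert j0 I. x i \<cdot> B i j) = (\<Sum>i\<in>I. x i \<cdot> A i j)" for x j
    using assms fin by (auto simp: B_def intro!: sum.cong)
  have sc: "(\<Sum>i\<in>insert j0 I. x i \<cdot> c i) = - b j0 \<longleftrightarrow> x j0 = (\<Sum>i\<in>I. x i \<cdot> A i j0) + b j0"
    if "x j0 \<in> V" for x
  proof -
    have "(\<Sum>i\<in>I. x i \<cdot> c i) = (\<Sum>i\<in>I. x i \<cdot> A i j0)"
      using assms by (auto simp: c_def intro!: sum.cong)
    then have *: "(\<Sum>i\<in>insert j0 I. x i \<cdot> c i) = - x j0 + (\<Sum>i\<in>I. x i \<cdot> A i j0)"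
      using assms fin that by (simp add: c_def sc_minus_right sc_one)
    show ?thesis unfolding * by (auto simp: algebra_simps)
  qed
  have "solved S I A b = {x \<in> solved S (insert j0 I) B b. (\<Sum>i\<in>insert j0 I. x i \<cdot> c i) = - b j0}"
  proof (rule Set.set_eqI)
    fix x
    have "x \<in> solved S I A b \<longleftrightarrow>
        x \<in> solved S (insert j0 I) B b \<and> x j0 = (\<Sum>i\<in>I. x i \<cdot> A i j0) + b j0"
      unfolding solved_def sB S by auto
    also have "\<dots> \<longleftrightarrow> x \<in> solved S (insert j0 I) B b \<and> (\<Sum>i\<in>insert j0 I. x i \<cdot> c i) = - b j0"
      using sc[of x] assms by (auto simp: solved_def PiE_iff)
    finally show "x \<in> solved S I A b \<longleftrightarrow>
        x \<in> {x \<in> solved S (insert j0 I) B b. (\<Sum>i\<in>insert j0 I. x i \<cdot> c i) = - b j0}" by simp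
  qed
  moreover have "affine_on S (insert j0 I - {i0}) \<dots>"
    using assms by (intro affine_on_pivot minus_in_V) (auto simp: c_def)
  moreover have "insert j0 I - {i0} = insert j0 (I - {i0})" using assms by auto
  ultimately show ?thesis by simp
qed

text \<open>Eliminating the dependent coordinates leaves an equation in the free ones. A surviving
  coefficient is a pivot; if there is none, the equation is constant, and one solution makes it hold
  on all of \<open>X\<close>.\<close>

lemma affine_on_equation:
  assumes X: "affine_on S I X" and e: "e \<in> V"
    and ne: "{x \<in> X. (\<Sum>s\<in>S. x s \<cdot> c s) = e} \<noteq> {}"
  shows "\<exists>I'. affine_on S I' {x \<in> X. (\<Sum>s\<in>S. x s \<cdot> c s) = e}"
proof -
  from X obtain A b where S: "finite S" "I \<subseteq> S" and b: "b \<in> S \<rightarrow> V" and X': "X = solved S I A b"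
    by (auto simp: affine_on_def)
  have fin: "finite I" using S finite_subset by blast
  define c' where "c' i = c i + (\<Sum>j\<in>S - I. A i j * c j)" for i
  define e' where "e' = e - (\<Sum>j\<in>S - I. b j \<cdot> c j)"
  have eq: "(\<Sum>s\<in>S. x s \<cdot> c s) = e \<longleftrightarrow> (\<Sum>i\<in>I. x i \<cdot> c' i) = e'" if x: "x \<in> X" for x
  proof -
    have "(\<Sum>s\<in>S. x s \<cdot> c s) = (\<Sum>s\<in>I. x s \<cdot> c s) + (\<Sum>j\<in>S - I. x j \<cdot> c j)"
      using S by (metis add.commute sum.subset_diff)
    also have "(\<Sum>j\<in>S - I. x j \<cdot> c j) = (\<Sum>j\<in>S - I. ((\<Sum>i\<in>I. x i \<cdot> A i j) + b j) \<cdot> c j)"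
      using x by (intro sum.cong) (auto simp: X' solved_def)
    also have "\<dots> = (\<Sum>j\<in>S - I. \<Sum>i\<in>I. x i \<cdot> (A i j * c j)) + (\<Sum>j\<in>S - I. b j \<cdot> c j)"
      by (simp add: sc_add_left sc_sum_left sc_mult sum.distrib)
    also have "(\<Sum>j\<in>S - I. \<Sum>i\<in>I. x i \<cdot> (A i j * c j)) = (\<Sum>i\<in>I. x i \<cdot> (\<Sum>j\<in>S - I. A i j * c j))"
      by (subst sum.swap) (simp add: sc_sum_right)
    finally have "(\<Sum>s\<in>S. x s \<cdot> c s) = (\<Sum>i\<in>I. x i \<cdot> c' i) + (\<Sum>j\<in>S - I. b j \<cdot> c j)"
      by (simp add: c'_def sc_add_right sum.distrib add_ac)
    then show ?thesis by (auto simp: e'_def algebra_simps)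
  qed
  have e': "e' \<in> V" using e by (simp add: e'_def)
  have Xeq: "{x \<in> X. (\<Sum>s\<in>S. x s \<cdot> c s) = e} = {x \<in> solved S I A b. (\<Sum>i\<in>I. x i \<cdot> c' i) = e'}"
    using eq X' by auto
  show ?thesis
  proof (cases "\<exists>i\<in>I. c' i \<noteq> 0")
    case True
    then show ?thesis
      unfolding Xeq using affine_on_pivot[OF S b _ _ e'] by blast
  next
    case False
    then have "(\<Sum>i\<in>I. x i \<cdot> c' i) = 0" for x
      by simp
    with ne have "{x \<in> X. (\<Sum>s\<in>S. x s \<cdot> c s) = e} = X"
      using eq by auto
    with X show ?thesis by auto
  qed
qed

lemma affine_on_equations:
  assumes "finite E" "affine_on S I X" "\<And>c e. (c, e) \<in> E \<Longrightarrow> e \<in> V"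
    and "{x \<in> X. \<forall>(c, e)\<in>E. (\<Sum>s\<in>S. x s \<cdot> c s) = e} \<noteq> {}"
  shows "\<exists>I'. affine_on S I' {x \<in> X. \<forall>(c, e)\<in>E. (\<Sum>s\<in>S. x s \<cdot> c s) = e}"
  using assms
proof (induction E rule: finite_induct)
  case empty
  then show ?case by auto
next
  case (insert p E)
  obtain c e where p: "p = (c, e)" by fastforce
  let ?Y = "{x \<in> X. \<forall>(c, e)\<in>E. (\<Sum>s\<in>S. x s \<cdot> c s) = e}"
  have *: "{x \<in> X. \<forall>(c, e)\<in>insert p E. (\<Sum>s\<in>S. x s \<cdot> c s) = e} =
      {x \<in> ?Y. (\<Sum>s\<in>S. x s \<cdot> c s) = e}"
    by (auto simp: p)
  \<comment> \<open>Fewer equations have more solutions, so the induction hypothesis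
    applies.\<close>
  from insert.prems(3) have "?Y \<noteq> {}" by auto
  then obtain J where "affine_on S J ?Y"
    using insert.IH insert.prems by blast
  then show ?case
    using affine_on_equation[of S J ?Y e c] insert.prems(2,3) unfolding * by (auto simp: p)
qed

section \<open>Projections of affine sets\<close>

text \<open>A dependent coordinate can be forgotten together with its equation. A free
  \<open>s\<close> on which some \<open>j\<close> depends is first made dependent by exchange. If
  nothing depends on \<open>s\<close>, its value is arbitrary and \<open>s\<close> just leaves the
  free coordinates.\<close>

lemma affine_on_drop_coordinate:
  assumes "affine_on S I X" "s \<in> S"
  shows "\<exists>I'. affine_on (S - {s}) I' ((\<lambda>x. restrict x (S - {s})) ` X)"
proof -
  let ?T = "S - {s}"
  have drop_dependent: "affine_on ?T J ((\<lambda>x. restrict x ?T) ` solved S J A b)"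
    if S: "finite S" "J \<subseteq> ?T" and b: "b \<in> S \<rightarrow> V" for J A b
  proof -
    have "(\<lambda>x. restrict x ?T) ` solved S J A b = solved ?T J A b"
    proof (intro equalityI subsetI)
      fix y assume "y \<in> (\<lambda>x. restrict x ?T) ` solved S J A b"
      then obtain x where x: "x \<in> solved S J A b" and y: "y = restrict x ?T" by blast
      have "(\<Sum>i\<in>J. y i \<cdot> A i j) = (\<Sum>i\<in>J. x i \<cdot> A i j)" for j
        using S by (intro sum.cong) (auto simp: y)
      moreover have "y \<in> ?T \<rightarrow>\<^sub>E V" using x by (auto simp: y solved_def PiE_iff)
      ultimately show "y \<in> solved ?T J A b"
        using x by (simp add: solved_def) (simp add: y)
    next
      fix y assume y: "y \<in> solved ?T J A b"
      \<comment> \<open>The missing coordinate is recovered from its own equation.\<close>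
      define x where "x = y(s := (\<Sum>i\<in>J. y i \<cdot> A i s) + b s)"
      have eq: "x i = y i" if "i \<in> ?T" for i using that by (auto simp: x_def)
      have sum: "(\<Sum>i\<in>J. x i \<cdot> A i j) = (\<Sum>i\<in>J. y i \<cdot> A i j)" for j
        using S eq by (intro sum.cong) (auto simp: subset_iff)
      have "x \<in> solved S J A b"
        unfolding solved_def
      proof (intro CollectI conjI ballI)
        have "b s \<in> V" using b \<open>s \<in> S\<close> by auto
        then show "x \<in> S \<rightarrow>\<^sub>E V"
          using y \<open>s \<in> S\<close> by (auto simp: solved_def PiE_iff x_def extensional_def)
        fix j assume "j \<in> S - J"
        then show "x j = (\<Sum>i\<in>J. x i \<cdot> A i j) + b j"
          unfolding sum using y by (auto simp: solved_def x_def)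
      qed
      moreover have "y = restrict x ?T"
        using y PiE_restrict[of y ?T "\<lambda>_. V"] restrict_ext[of ?T x y, OF eq]
        by (auto simp only: solved_def)
      ultimately show "y \<in> (\<lambda>x. restrict x ?T) ` solved S J A b" by blast
    qed
    then show ?thesis using S b by (auto simp: intro!: affine_on_solved)
  qed
  from assms obtain A b where S: "finite S" "I \<subseteq> S" and b: "b \<in> S \<rightarrow> V" and X: "X = solved S I A b"
    by (auto simp: affine_on_def)
  have fin: "finite I" using S finite_subset by blast
  consider "s \<notin> I" | j where "s \<in> I" "j \<in> S - I" "A s j \<noteq> 0"
    | "s \<in> I" "\<And>j. j \<in> S - I \<Longrightarrow> A s j = 0" by blast
  then show ?thesis
  proof cases
    case 1
    then show ?thesis using drop_dependent[of I b A] S b X by auto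
  next
    case 2
    then have "affine_on S (insert j (I - {s})) X"
      using affine_on_exchange S b X by simp
    then obtain A' b' where "b' \<in> S \<rightarrow> V" "X = solved S (insert j (I - {s})) A' b'"
      by (auto simp: affine_on_def)
    then show ?thesis
      using drop_dependent[of "insert j (I - {s})" b' A'] S 2 by blast
  next
    case 3
    have sum: "(\<Sum>i\<in>I. x i \<cdot> A i j) = (\<Sum>i\<in>I - {s}. x i \<cdot> A i j)" if "j \<in> S - I" for x j
      using fin 3 that by (simp add: sum.remove[of I s])
    have T: "?T - (I - {s}) = S - I" using 3 by auto
    have "(\<lambda>x. restrict x ?T) ` X = solved ?T (I - {s}) A b"
    proof (intro equalityI subsetI)
      fix y assume "y \<in> (\<lambda>x. restrict x ?T) ` X"
      then obtain x where x: "x \<in> solved S I A b" and y: "y = restrict x ?T" using X by blast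
      have sum': "(\<Sum>i\<in>I - {s}. y i \<cdot> A i j) = (\<Sum>i\<in>I - {s}. x i \<cdot> A i j)" for j
        using S by (intro sum.cong) (auto simp: y)
      have "y \<in> ?T \<rightarrow>\<^sub>E V" using x by (auto simp: y solved_def PiE_iff)
      moreover have "y j = (\<Sum>i\<in>I - {s}. y i \<cdot> A i j) + b j" if "j \<in> S - I" for j
        unfolding sum' using x sum[OF that] that 3(1) by (auto simp: solved_def y)
      ultimately show "y \<in> solved ?T (I - {s}) A b"
        unfolding solved_def T by blast
    next
      fix y assume y: "y \<in> solved ?T (I - {s}) A b"
      \<comment> \<open>No equation involves \<open>s\<close>, so any value in \<open>V\<close>
        would extend \<open>y\<close>; zero is chosen.\<close>
      define x where "x = y(s := 0)"
      have eq: "x i = y i" if "i \<in> ?T" for i using that by (auto simp: x_def)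
      have sum': "(\<Sum>i\<in>I - {s}. x i \<cdot> A i j) = (\<Sum>i\<in>I - {s}. y i \<cdot> A i j)" for j
        using S eq by (intro sum.cong) auto
      have "x \<in> solved S I A b"
        unfolding solved_def
      proof (intro CollectI conjI ballI)
        show "x \<in> S \<rightarrow>\<^sub>E V"
          using y \<open>s \<in> S\<close> by (auto simp: solved_def PiE_iff x_def extensional_def)
        fix j assume "j \<in> S - I"
        then show "x j = (\<Sum>i\<in>I. x i \<cdot> A i j) + b j"
          using y 3(1) sum sum' by (auto simp: solved_def x_def)
      qed
      moreover have "y = restrict x ?T"
        using y PiE_restrict[of y ?T "\<lambda>_. V"] restrict_ext[of ?T x y, OF eq]
        by (auto simp only: solved_def)
      ultimately show "y \<in> (\<lambda>x. restrict x ?T) ` X" unfolding X by blast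
    qed
    then show ?thesis
      using affine_on_solved[of ?T "I - {s}" b A] S b by fastforce
  qed
qed

lemma affine_on_restrict:
  assumes "affine_on S I X" "T \<subseteq> S"
  shows "\<exists>I'. affine_on T I' ((\<lambda>x. restrict x T) ` X)"
proof -
  have "finite S" using assms by (simp add: affine_on_def)
  then have "finite (S - T)" by simp
  \<comment> \<open>Coordinates are removed one at a time; the case \<open>D = S - T\<close> is the
    claim.\<close>
  moreover have "\<exists>I'. affine_on (S - D) I' ((\<lambda>x. restrict x (S - D)) ` X)"
    if "finite D" "D \<subseteq> S" for D
    using that
  proof (induction D rule: finite_induct)
    case empty
    have "(\<lambda>x. restrict x S) ` X = X"
      using assms(1) by (intro trans[OF image_cong image_ident] refl)
        (auto simp: affine_on_def solved_def)
    then show ?case using assms(1) by (auto simp del: restrict_apply)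
  next
    case (insert s D)
    then obtain J where "affine_on (S - D) J ((\<lambda>x. restrict x (S - D)) ` X)" by blast
    from affine_on_drop_coordinate[OF this, of s] insert
    have "\<exists>I'. affine_on (S - D - {s}) I' ((\<lambda>x. restrict x ((S - D) \<inter> (S - D - {s}))) ` X)"
      by (simp add: image_image)
    moreover have "(S - D) \<inter> (S - D - {s}) = S - insert s D" "S - D - {s} = S - insert s D"
      by auto
    ultimately show ?case by (simp only:)
  qed
  ultimately have "\<exists>I'. affine_on (S - (S - T)) I' ((\<lambda>x. restrict x (S - (S - T))) ` X)"
    by blast
  then show ?thesis using \<open>T \<subseteq> S\<close> by (simp add: double_diff)
qed

section \<open>Invariance of the number of free coordinates\<close>

text \<open>
  Steinitz exchange towards \<open>J\<close>: an \<open>i \<in> I - J\<close> on which no coordinate in \<open>J - I\<close> depends would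
  contradict injectivity, and once \<open>I \<subseteq> J\<close>, a coordinate in \<open>J - I\<close> would contradict surjectivity.
\<close>

lemma affine_on_card_eq:
  assumes "affine_on S I X" "J \<subseteq> S" "V \<noteq> {0}"
    and "bij_betw (\<lambda>x. restrict x J) X (J \<rightarrow>\<^sub>E V)"
  shows "card I = card J"
  using assms(1)
proof (induction "card (I - J)" arbitrary: I rule: less_induct)
  case less
  obtain v where v: "v \<in> V" "v \<noteq> 0" using assms(3) zero_in_V by blast
  from less.prems obtain A b
    where S: "finite S" "I \<subseteq> S" and b: "b \<in> S \<rightarrow> V" and X: "X = solved S I A b"
    by (auto simp: affine_on_def)
  have fin: "finite I" "finite J" using S assms finite_subset by blast+
  note bij = affine_on_bij_betw[OF less.prems]
  show ?case
  proof (cases "I \<subseteq> J")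
    case False
    then obtain i where i: "i \<in> I" "i \<notin> J" by blast
    have "\<exists>j\<in>J - I. A i j \<noteq> 0"
    proof (rule ccontr)
      assume "\<not> ?thesis"
      then have A0: "A i j = 0" if "j \<in> J - I" for j using that by blast
      \<comment> \<open>These families differ only at \<open>i\<close>. Since
        \<open>i \<notin> J\<close> and no coordinate in \<open>J - I\<close> depends on
        \<open>i\<close>, the points above them agree on \<open>J\<close>.\<close>
      have "(\<lambda>k\<in>I. 0) \<in> I \<rightarrow>\<^sub>E V" "(\<lambda>k\<in>I. if k = i then v else 0) \<in> I \<rightarrow>\<^sub>E V"
        using v by auto
      then obtain x y where xy: "x \<in> X" "y \<in> X"
        and "restrict x I = (\<lambda>k\<in>I. 0)" "restrict y I = (\<lambda>k\<in>I. if k = i then v else 0)"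
        using bij by (metis (no_types, lifting) bij_betw_imp_surj_on imageE)
      then have x: "x k = 0" and y: "y k = (if k = i then v else 0)" if "k \<in> I" for k
        using that by (auto dest: restrict_eqD)
      have "x j = y j" if "j \<in> J" for j
      proof (cases "j \<in> I")
        case True
        then show ?thesis using x y that i by auto
      next
        case False
        then have "(\<Sum>k\<in>I. x k \<cdot> A k j) = (\<Sum>k\<in>I. y k \<cdot> A k j)"
          using x y A0 that by (intro sum.cong) auto
        then show ?thesis using xy that False assms(2) by (auto simp: X solved_def)
      qed
      then have "restrict x J = restrict y J" by (intro restrict_ext)
      then have "x = y" using xy assms(4) by (auto simp: bij_betw_def inj_on_def)
      then show False using x[of i] y[of i] i v by auto
    qed
    then obtain j where j: "j \<in> J - I" "A i j \<noteq> 0" by blast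
    let ?I = "insert j (I - {i})"
    \<comment> \<open>The exchange removes \<open>i\<close> from \<open>I - J\<close> and adds
      nothing, so the induction measure drops.\<close>
    have "?I - J \<subset> I - J" using i j by auto
    then have "card (?I - J) < card (I - J)" using fin by (intro psubset_card_mono) auto
    moreover have "affine_on S ?I X"
      unfolding X by (rule affine_on_exchange) (use S b i j assms(2) in auto)
    ultimately have "card ?I = card J" by (rule less.hyps)
    then show ?thesis using i j fin card_Suc_Diff1[of I i] by simp
  next
    case True
    have "J \<subseteq> I"
    proof (rule ccontr)
      assume "\<not> ?thesis"
      then obtain j where j: "j \<in> J" "j \<notin> I" by blast
      \<comment> \<open>The points above these families differ at \<open>j\<close> but agree on
        \<open>I\<close>, because \<open>I \<subseteq> J\<close> and
        \<open>j \<notin> I\<close>.\<close>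
      have "(\<lambda>k\<in>J. 0) \<in> J \<rightarrow>\<^sub>E V" "(\<lambda>k\<in>J. if k = j then v else 0) \<in> J \<rightarrow>\<^sub>E V"
        using v by auto
      then obtain x y where xy: "x \<in> X" "y \<in> X"
        and "restrict x J = (\<lambda>k\<in>J. 0)" "restrict y J = (\<lambda>k\<in>J. if k = j then v else 0)"
        using assms(4) by (metis (no_types, lifting) bij_betw_imp_surj_on imageE)
      then have x: "x k = 0" and y: "y k = (if k = j then v else 0)" if "k \<in> J" for k
        using that by (auto dest: restrict_eqD)
      have "restrict x I = restrict y I"
        using x y True j by (intro restrict_ext) auto
      then have "x = y" using xy bij by (auto simp: bij_betw_def inj_on_def)
      then show False using x[of j] y[of j] j v by auto
    qed
    then show ?thesis using True by simp
  qed
qed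

section \<open>Products and coordinate projections of affine sets\<close>

text \<open>The systems of the two factors do not interact, so together they form a block-diagonal
  system. The map \<open>h\<close> moves the second index set away from the first.\<close>

lemma affine_on_prod:
  assumes X: "affine_on S I X" and Y: "affine_on T J Y" and h: "inj_on h T" "S \<inter> h ` T = {}"
  shows "affine_on (S \<union> h ` T) (I \<union> h ` J)
    {z \<in> S \<union> h ` T \<rightarrow>\<^sub>E V. restrict z S \<in> X \<and> (\<lambda>t\<in>T. z (h t)) \<in> Y}"
proof -
  from X obtain A b where S: "finite S" "I \<subseteq> S" and b: "b \<in> S \<rightarrow> V" and X': "X = solved S I A b"
    by (auto simp: affine_on_def)
  from Y obtain B c where T: "finite T" "J \<subseteq> T" and c: "c \<in> T \<rightarrow> V" and Y': "Y = solved T J B c"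
    by (auto simp: affine_on_def)
  define g where "g = inv_into T h"
  have g: "g (h t) = t" if "t \<in> T" for t using that h by (simp add: g_def)
  \<comment> \<open>Indices outside \<open>S\<close> are pulled back to \<open>T\<close> by
    \<open>g\<close>; the mixed blocks are zero.\<close>
  define C where "C i j = (if i \<in> S \<and> j \<in> S then A i j
      else if i \<notin> S \<and> j \<notin> S then B (g i) (g j) else 0)" for i j
  define d where "d j = (if j \<in> S then b j else c (g j))" for j
  have fin: "finite I" "finite J" using S T finite_subset by blast+
  have notS: "h t \<notin> S" if "t \<in> T" for t using that h by blast
  have dis: "I \<inter> h ` J = {}" using S T notS by blast
  have injJ: "inj_on h J" using h T inj_on_subset by blast
  have sum: "(\<Sum>i\<in>I \<union> h ` J. z i \<cdot> C i j) = (\<Sum>i\<in>I. z i \<cdot> C i j) + (\<Sum>i\<in>J. z (h i) \<cdot> C (h i) j)" for z j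
    using fin dis by (simp add: sum.union_disjoint sum.reindex[OF injJ])
  have sum1: "(\<Sum>i\<in>I \<union> h ` J. z i \<cdot> C i j) = (\<Sum>i\<in>I. z i \<cdot> A i j)" if "j \<in> S" for z j
  proof -
    have "(\<Sum>i\<in>I. z i \<cdot> C i j) = (\<Sum>i\<in>I. z i \<cdot> A i j)"
      using S that by (intro sum.cong) (auto simp: C_def)
    moreover have "(\<Sum>i\<in>J. z (h i) \<cdot> C (h i) j) = 0"
      using T that notS by (intro sum.neutral) (auto simp: C_def)
    ultimately show ?thesis unfolding sum by simp
  qed
  have sum2: "(\<Sum>i\<in>I \<union> h ` J. z i \<cdot> C i (h j)) = (\<Sum>i\<in>J. z (h i) \<cdot> B i j)" if "j \<in> T" for z j
  proof -
    have "(\<Sum>i\<in>I. z i \<cdot> C i (h j)) = 0"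
      using S that notS by (intro sum.neutral) (auto simp: C_def)
    moreover have "(\<Sum>i\<in>J. z (h i) \<cdot> C (h i) (h j)) = (\<Sum>i\<in>J. z (h i) \<cdot> B i j)"
      using T that notS g by (intro sum.cong) (auto simp: C_def subset_iff)
    ultimately show ?thesis unfolding sum by simp
  qed
  have split: "(S \<union> h ` T) - (I \<union> h ` J) = (S - I) \<union> h ` (T - J)"
  proof -
    have "h ` T - h ` J = h ` (T - J)" using inj_on_image_set_diff[OF h(1)] T by auto
    moreover have "S - h ` J = S" "h ` T - I = h ` T" using S T h by blast+
    ultimately show ?thesis by blast
  qed
  have "{z \<in> S \<union> h ` T \<rightarrow>\<^sub>E V. restrict z S \<in> X \<and> (\<lambda>t\<in>T. z (h t)) \<in> Y} =
      solved (S \<union> h ` T) (I \<union> h ` J) C d"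
  proof (rule Set.set_eqI)
    fix z
    have "restrict z S \<in> X \<and> (\<lambda>t\<in>T. z (h t)) \<in> Y \<longleftrightarrow> z \<in> solved (S \<union> h ` T) (I \<union> h ` J) C d"
      if z: "z \<in> S \<union> h ` T \<rightarrow>\<^sub>E V"
    proof -
      have rI: "(\<Sum>i\<in>I. restrict z S i \<cdot> A i j) = (\<Sum>i\<in>I. z i \<cdot> A i j)" for j
        using S by (intro sum.cong) auto
      have rJ: "(\<Sum>i\<in>J. (\<lambda>t\<in>T. z (h t)) i \<cdot> B i j) = (\<Sum>i\<in>J. z (h i) \<cdot> B i j)" for j
        using T by (intro sum.cong) auto
      have 1: "restrict z S \<in> X \<longleftrightarrow> (\<forall>j\<in>S - I. z j = (\<Sum>i\<in>I. z i \<cdot> A i j) + b j)"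
        unfolding X' solved_def mem_Collect_eq rI using z by auto
      have 2: "(\<lambda>t\<in>T. z (h t)) \<in> Y \<longleftrightarrow> (\<forall>j\<in>T - J. z (h j) = (\<Sum>i\<in>J. z (h i) \<cdot> B i j) + c j)"
        unfolding Y' solved_def mem_Collect_eq rJ using z by auto
      have "z \<in> solved (S \<union> h ` T) (I \<union> h ` J) C d \<longleftrightarrow>
          (\<forall>j\<in>S - I. z j = (\<Sum>i\<in>I. z i \<cdot> A i j) + b j) \<and>
          (\<forall>j\<in>T - J. z (h j) = (\<Sum>i\<in>J. z (h i) \<cdot> B i j) + c j)"
        unfolding solved_def mem_Collect_eq split ball_Un ball_simps
        using z by (auto simp: sum1 sum2 d_def notS g)
      then show ?thesis unfolding 1 2 by simp
    qed
    then show "z \<in> {z \<in> S \<union> h ` T \<rightarrow>\<^sub>E V. restrict z S \<in> X \<and> (\<lambda>t\<in>T. z (h t)) \<in> Y} \<longleftrightarrow>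
        z \<in> solved (S \<union> h ` T) (I \<union> h ` J) C d"
      by (auto simp: solved_def)
  qed
  moreover have "d \<in> S \<union> h ` T \<rightarrow> V"
    using b c g notS by (auto simp: d_def)
  moreover have "I \<union> h ` J \<subseteq> S \<union> h ` T" using S T by blast
  ultimately show ?thesis
    using S T affine_on_solved[of "S \<union> h ` T" "I \<union> h ` J" d C] by simp
qed

text \<open>The zero family on the free coordinates extends to a point.\<close>

lemma affine_on_nonempty:
  assumes "affine_on S I X"
  shows "X \<noteq> {}"
proof -
  have "(\<lambda>i\<in>I. 0) \<in> I \<rightarrow>\<^sub>E V" by simp
  then show ?thesis
    using bij_betw_imp_surj_on[OF affine_on_bij_betw[OF assms]] by blast
qed

text \<open>As \<open>g\<close> copies coordinates, the free coordinates of \<open>Y\<close>,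
  transported by \<open>h\<close>, also parametrise \<open>X\<close>, and
  \<open>affine_on_card_eq\<close> applies inside \<open>X\<close>. This will serve for both
  projections of a graph.\<close>

lemma affine_on_bij_card_eq:
  assumes X: "affine_on S I X" and Y: "affine_on T J Y" and nz: "V \<noteq> {0}"
    and g: "bij_betw g X Y" and h: "inj_on h J" "h ` J \<subseteq> S"
    and gh: "\<And>x j. x \<in> X \<Longrightarrow> j \<in> J \<Longrightarrow> g x j = x (h j)"
  shows "card I = card J"
proof -
  have XS: "x \<in> S \<rightarrow>\<^sub>E V" if "x \<in> X" for x
    using X that by (auto simp: affine_on_def solved_def)
  have bijY: "bij_betw (\<lambda>x. restrict x J) Y (J \<rightarrow>\<^sub>E V)"
    using Y by (rule affine_on_bij_betw)
  have "bij_betw (\<lambda>x. restrict x (h ` J)) X (h ` J \<rightarrow>\<^sub>E V)"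
  proof (rule bij_betwI')
    fix x y assume xy: "x \<in> X" "y \<in> X"
    show "(restrict x (h ` J) = restrict y (h ` J)) = (x = y)"
    proof
      assume "restrict x (h ` J) = restrict y (h ` J)"
      then have "x (h j) = y (h j)" if "j \<in> J" for j
        using that by (blast dest: restrict_eqD)
      then have "restrict (g x) J = restrict (g y) J"
        using xy gh by (intro restrict_ext) simp
      moreover have "g x \<in> Y" "g y \<in> Y" using g xy by (auto simp: bij_betw_def)
      ultimately have "g x = g y" using bijY by (auto simp: bij_betw_def inj_on_def)
      then show "x = y" using g xy by (auto simp: bij_betw_def inj_on_def)
    qed simp
  next
    fix x assume "x \<in> X"
    then show "restrict x (h ` J) \<in> h ` J \<rightarrow>\<^sub>E V"
      using XS h by (auto simp: PiE_iff)
  next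
    fix w assume w: "w \<in> h ` J \<rightarrow>\<^sub>E V"
    then have "(\<lambda>j\<in>J. w (h j)) \<in> J \<rightarrow>\<^sub>E V" by (auto simp: PiE_iff)
    then obtain y where y: "y \<in> Y" "restrict y J = (\<lambda>j\<in>J. w (h j))"
      using bijY by (metis (no_types, lifting) bij_betw_imp_surj_on imageE)
    then obtain x where x: "x \<in> X" "g x = y"
      using g by (metis bij_betw_imp_surj_on imageE)
    have "w = restrict x (h ` J)"
    proof (rule PiE_ext[OF w])
      show "restrict x (h ` J) \<in> h ` J \<rightarrow>\<^sub>E V"
        using XS[OF x(1)] h by (auto simp: PiE_iff)
      fix i assume "i \<in> h ` J"
      then obtain j where j: "j \<in> J" "i = h j" by blast
      then show "w i = restrict x (h ` J) i"
        using gh[OF x(1) j(1)] x(2) restrict_eqD[OF y(2) j(1)] by simp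
    qed
    then show "\<exists>x\<in>X. w = restrict x (h ` J)" using x by blast
  qed
  then have "card I = card (h ` J)"
    using affine_on_card_eq[OF X h(2) nz] by simp
  then show ?thesis using h by (simp add: card_image)
qed

end

section \<open>Colours of modules over a matrix ring\<close>

lemma bij_betw_image_factor:
  "bij_betw v X Y \<Longrightarrow> (\<And>x. x \<in> X \<Longrightarrow> g (u x) = v x) \<Longrightarrow> bij_betw g (u ` X) Y"
  by (auto simp: bij_betw_def inj_on_def image_image)

text \<open>The bijection \<open>f\<close> carries addition to the operation of \<open>G\<close>,
  and multiplication by \<open>q\<close> identifies the naturals with the multiples of
  \<open>q\<close>.\<close>

lemma monoid_isomorphic_to_nat:
  fixes G :: "'a monoid" and f :: "nat \<Rightarrow> 'a"
  assumes carrier: "carrier G = range f" and "inj f"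
    and mult: "\<And>a b. f a \<otimes>\<^bsub>G\<^esub> f b = f (a + b)" and one: "\<one>\<^bsub>G\<^esub> = f 0"
    and "q \<ge> 1"
  shows "comm_monoid G" "G \<cong> multiples_monoid q" "G \<cong> nat_add_monoid"
proof -
  show "comm_monoid G"
    by (rule comm_monoidI) (auto simp: carrier mult one add_ac)
  have inv: "the_inv f (f a) = a" for a
    using \<open>inj f\<close> by (rule the_inv_f_f)
  \<comment> \<open>A general factor \<open>c\<close> covers both targets: \<open>c = q\<close>
    gives the multiples of \<open>q\<close>, and \<open>c = 1\<close> gives all naturals.\<close>
  have "(\<lambda>x. c * the_inv f x) \<in> iso G \<lparr>carrier = {c * k | k. True}, mult = (+), one = 0\<rparr>"
    if "c \<ge> 1" for c :: nat
  proof (rule isoI)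
    show "(\<lambda>x. c * the_inv f x) \<in> hom G \<lparr>carrier = {c * k | k. True}, mult = (+), one = 0\<rparr>"
      by (auto simp: hom_def carrier mult inv algebra_simps)
    show "bij_betw (\<lambda>x. c * the_inv f x) (carrier G)
        (carrier \<lparr>carrier = {c * k | k. True}, mult = (+), one = (0 :: nat)\<rparr>)"
      using that by (auto simp: bij_betw_def inj_on_def carrier inv image_iff)
  qed
  from this[OF \<open>q \<ge> 1\<close>] this[of 1]
  show "G \<cong> multiples_monoid q" "G \<cong> nat_add_monoid"
    by (auto simp: multiples_monoid_def nat_add_monoid_def is_iso_def)
qed

lemma lin_comb_append:
  assumes "length v = length c"
  shows "lin_comb act (v @ w) (c @ d) = lin_comb act v c + lin_comb act w d"
proof -
  let ?f = "\<lambda>i. act ((v @ w) ! i) ((c @ d) ! i)"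
  have "sum ?f {..<length v + length w} =
      sum ?f {..<length v} + (\<Sum>i<length w. ?f (i + length v))"
    using sum.atLeastLessThan_concat[of 0 "length v" "length v + length w" ?f]
      sum.shift_bounds_nat_ivl[of ?f 0 "length v" "length w"]
    by (simp add: atLeast0LessThan add.commute)
  also have "\<dots> = lin_comb act v c + lin_comb act w d"
    using assms by (simp add: lin_comb_def nth_append)
  finally show ?thesis by (simp add: lin_comb_def)
qed

section \<open>Matrix units acting on the module\<close>

locale matrix_module = right_module "ring_mat TYPE('r :: division_ring) q ()" act
  for q :: nat and act :: "'m :: ab_group_add \<Rightarrow> 'r :: division_ring mat \<Rightarrow> 'm" (infixl \<open>\<star>\<close> 70) +
  assumes q_pos: "0 < q"
begin

lemma star_add_left: "C \<in> carrier_mat q q \<Longrightarrow> (x + y) \<star> C = x \<star> C + y \<star> C"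
  using act_add_left by (simp add: ring_mat_simps)

lemma star_add_right:
  "C \<in> carrier_mat q q \<Longrightarrow> D \<in> carrier_mat q q \<Longrightarrow> x \<star> (C + D) = x \<star> C + x \<star> D"
  using act_add_right by (simp add: ring_mat_simps)

lemma star_mult:
  "C \<in> carrier_mat q q \<Longrightarrow> D \<in> carrier_mat q q \<Longrightarrow> x \<star> (C * D) = x \<star> C \<star> D"
  using act_mult by (simp add: ring_mat_simps)

lemma star_one: "x \<star> 1\<^sub>m q = x"
  using act_one by (simp add: ring_mat_simps)

lemma star_zero_left: "C \<in> carrier_mat q q \<Longrightarrow> 0 \<star> C = 0"
  using star_add_left[of C 0 0] by simp

lemma star_zero_right: "x \<star> 0\<^sub>m q q = 0"
  using star_add_right[of "0\<^sub>m q q" "0\<^sub>m q q" x] by simp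

lemma star_sum_left: "C \<in> carrier_mat q q \<Longrightarrow> (\<Sum>i\<in>I. f i) \<star> C = (\<Sum>i\<in>I. f i \<star> C)"
  by (induction I rule: infinite_finite_induct) (auto simp: star_add_left star_zero_left)

text \<open>The matrices are summed entry by entry inside \<open>mat\<close>, which fixes the
  dimension; the empty sum is \<open>0\<^sub>m q q\<close>.\<close>

lemma star_sum_right:
  assumes "finite I"
  shows "x \<star> mat q q (\<lambda>p. \<Sum>i\<in>I. g i p) = (\<Sum>i\<in>I. x \<star> mat q q (g i))"
  using assms
proof (induction I rule: finite_induct)
  case empty
  have "mat q q (\<lambda>p. \<Sum>i\<in>{}. g i p) = 0\<^sub>m q q" by (rule eq_matI) auto
  then show ?case by (simp add: star_zero_right)
next
  case (insert i I)
  then have "mat q q (\<lambda>p. \<Sum>i\<in>insert i I. g i p) = mat q q (g i) + mat q q (\<lambda>p. \<Sum>i\<in>I. g i p)"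
    by (intro eq_matI) auto
  then show ?case using insert by (simp add: star_add_right)
qed

definition unit_mat :: "nat \<Rightarrow> nat \<Rightarrow> 'r \<Rightarrow> 'r mat" where
  "unit_mat i j r = mat q q (\<lambda>(a, b). if a = i \<and> b = j then r else 0)"

lemma unit_mat_carrier [simp]: "unit_mat i j r \<in> carrier_mat q q"
  by (simp add: unit_mat_def)

lemma unit_mat_add: "unit_mat i j (r + s) = unit_mat i j r + unit_mat i j s"
  by (intro eq_matI) (auto simp: unit_mat_def)

lemma mult_unit_mat:
  assumes "C \<in> carrier_mat q q" "i < q"
  shows "C * unit_mat i j r = mat q q (\<lambda>(a, b). if b = j then C $$ (a, i) * r else 0)"
proof (rule eq_matI)
  fix a b assume "a < dim_row (mat q q (\<lambda>(a, b). if b = j then C $$ (a, i) * r else 0))"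
    "b < dim_col (mat q q (\<lambda>(a, b). if b = j then C $$ (a, i) * r else 0))"
  then have ab: "a < q" "b < q" by auto
  have "(C * unit_mat i j r) $$ (a, b) = (\<Sum>k<q. C $$ (a, k) * unit_mat i j r $$ (k, b))"
    using ab assms by (auto simp: scalar_prod_def atLeast0LessThan unit_mat_def intro!: sum.cong)
  also have "\<dots> = (\<Sum>k<q. if k = i then (if b = j then C $$ (a, i) * r else 0) else 0)"
    using ab by (intro sum.cong) (auto simp: unit_mat_def)
  also have "\<dots> = (if b = j then C $$ (a, i) * r else 0)"
    using assms by simp
  finally show "(C * unit_mat i j r) $$ (a, b) =
      mat q q (\<lambda>(a, b). if b = j then C $$ (a, i) * r else 0) $$ (a, b)"
    using ab by simp
qed (use assms in \<open>auto simp: unit_mat_def\<close>)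

lemma unit_mat_mult:
  "k < q \<Longrightarrow> unit_mat i j r * unit_mat k l s = (if j = k then unit_mat i l (r * s) else 0\<^sub>m q q)"
  by (subst mult_unit_mat; (rule eq_matI)?) (auto simp: unit_mat_def)

text \<open>The map \<open>r \<mapsto> unit_mat 0 0 r\<close> embeds \<open>R\<close> as the corner
  with unit \<open>E_00\<close>, so \<open>V\<close> becomes \<open>M E_00\<close>.\<close>

definition sc :: "'m \<Rightarrow> 'r \<Rightarrow> 'm" (infixl \<open>\<cdot>\<close> 70) where
  "x \<cdot> r = x \<star> unit_mat 0 0 r"

sublocale nonunital_right_space sc
  by unfold_locales
    (simp_all add: sc_def star_add_left star_add_right unit_mat_add unit_mat_mult[OF q_pos]
      flip: star_mult)

section \<open>Coordinates of an element of the module\<close>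

text \<open>The isomorphism \<open>M \<cong> V\<^sup>q\<close> sends \<open>x\<close> to the family \<open>x\<cdot>E\<^sub>k\<^sub>0\<close>, with inverse \<open>v \<mapsto> \<Sum>k. v\<^sub>k\<cdot>E\<^sub>0\<^sub>k\<close>.\<close>

definition coord :: "'m \<Rightarrow> nat \<Rightarrow> 'm" where
  "coord x k = x \<star> unit_mat k 0 1"

lemma coord_in_V [simp]: "coord x k \<in> V"
  using q_pos by (simp add: V_def sc_def coord_def unit_mat_mult flip: star_mult)

lemma coord_zero [simp]: "coord 0 k = 0"
  by (simp add: coord_def star_zero_left)

lemma coord_add: "coord (x + y) k = coord x k + coord y k"
  by (simp add: coord_def star_add_left)

lemma coord_sum: "coord (\<Sum>i\<in>I. f i) k = (\<Sum>i\<in>I. coord (f i) k)"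
  by (simp add: coord_def star_sum_left)

text \<open>In coordinates, \<open>x\<close> is a row vector over \<open>V\<close> on which
  \<open>C\<close> acts by the usual product: column \<open>l\<close> of \<open>C\<close> is moved
  to column \<open>0\<close> by \<open>E_l0\<close>, and each \<open>r E_k0\<close> factors as
  \<open>E_k0 (r E_00)\<close>.\<close>

lemma coord_star:
  assumes "C \<in> carrier_mat q q" "l < q"
  shows "coord (x \<star> C) l = (\<Sum>k<q. coord x k \<cdot> C $$ (k, l))"
proof -
  have "coord (x \<star> C) l = x \<star> (C * unit_mat l 0 1)"
    using assms by (simp add: coord_def star_mult)
  also have "C * unit_mat l 0 1 =
      mat q q (\<lambda>p. \<Sum>k<q. case p of (a, b) \<Rightarrow> if a = k \<and> b = 0 then C $$ (k, l) else 0)"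
    unfolding mult_unit_mat[OF assms]
    by (rule eq_matI) (auto simp: sum.delta' if_distrib cong: if_cong)
  also have "x \<star> \<dots> = (\<Sum>k<q. x \<star> unit_mat k 0 (C $$ (k, l)))"
    by (simp add: star_sum_right unit_mat_def)
  also have "\<dots> = (\<Sum>k<q. coord x k \<cdot> C $$ (k, l))"
    using q_pos by (simp add: coord_def sc_def unit_mat_mult flip: star_mult)
  finally show ?thesis .
qed

text \<open>The products \<open>E_k0 E_0k = E_kk\<close> add up to the identity matrix.\<close>

lemma sum_coord_star: "(\<Sum>k<q. coord x k \<star> unit_mat 0 k 1) = x"
proof -
  have "(\<Sum>k<q. coord x k \<star> unit_mat 0 k 1) = (\<Sum>k<q. x \<star> unit_mat k k 1)"
    using q_pos by (simp add: coord_def unit_mat_mult flip: star_mult)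
  also have "\<dots> = x \<star> mat q q (\<lambda>p. \<Sum>k<q. case p of (a, b) \<Rightarrow> if a = k \<and> b = k then 1 else 0)"
    by (simp add: star_sum_right unit_mat_def)
  also have "mat q q (\<lambda>p. \<Sum>k<q. case p of (a, b) \<Rightarrow> if a = k \<and> b = k then 1 else 0) = (1\<^sub>m q :: 'r mat)"
  proof -
    have "(\<Sum>k<q. if i = k \<and> j = k then 1 else 0) = (if i = j then 1 else (0 :: 'r))"
      if "i < q" for i j
    proof -
      have "(\<Sum>k<q. if i = k \<and> j = k then 1 else 0) =
          (\<Sum>k<q. if k = i then (if i = j then 1 else 0) else (0 :: 'r))"
        by (intro sum.cong) auto
      then show ?thesis using that by simp
    qed
    then show ?thesis
      unfolding one_mat_def by (intro cong_mat) simp_all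
  qed
  finally show ?thesis by (simp add: star_one)
qed

lemma coord_ext:
  assumes "\<And>k. k < q \<Longrightarrow> coord x k = coord y k"
  shows "x = y"
proof -
  have "(\<Sum>k<q. coord x k \<star> unit_mat 0 k 1) = (\<Sum>k<q. coord y k \<star> unit_mat 0 k 1)"
    by (intro sum.cong) (auto simp: assms)
  then show ?thesis by (simp only: sum_coord_star)
qed

text \<open>The product \<open>E_0k E_l0\<close> is zero unless \<open>k = l\<close>, when it is
  \<open>E_00\<close>, which fixes \<open>V\<close>.\<close>

lemma coord_assemble:
  assumes "\<And>k. k < q \<Longrightarrow> v k \<in> V" "l < q"
  shows "coord (\<Sum>k<q. v k \<star> unit_mat 0 k 1) l = v l"
proof -
  have "coord (\<Sum>k<q. v k \<star> unit_mat 0 k 1) l = (\<Sum>k<q. if k = l then v k \<cdot> 1 else 0)"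
    unfolding coord_sum using assms(2)
    by (intro sum.cong) (auto simp: coord_def sc_def unit_mat_mult star_zero_right simp flip: star_mult)
  then show ?thesis using assms by (simp add: sc_one)
qed

section \<open>Coordinates of tuples\<close>

text \<open>An index is a position in the tuple paired with a coordinate of the entry there.\<close>

definition idx :: "nat \<Rightarrow> (nat \<times> nat) set" where
  "idx n = {..<n} \<times> {..<q}"

definition coords :: "nat \<Rightarrow> 'm list \<Rightarrow> nat \<times> nat \<Rightarrow> 'm" where
  "coords n xs = (\<lambda>p\<in>idx n. coord (xs ! fst p) (snd p))"

lemma finite_idx [simp]: "finite (idx n)"
  by (simp add: idx_def)

lemma idx_mono: "n \<le> m \<Longrightarrow> idx n \<subseteq> idx m"
  by (auto simp: idx_def)

lemma coords_in: "coords n xs \<in> idx n \<rightarrow>\<^sub>E V"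
  by (auto simp: coords_def)

lemma coords_apply: "p \<in> idx n \<Longrightarrow> coords n xs p = coord (xs ! fst p) (snd p)"
  by (simp add: coords_def)

lemma coords_bij_betw: "bij_betw (coords n) (tuples n) (idx n \<rightarrow>\<^sub>E V)"
proof (rule bij_betwI')
  fix xs ys :: "'m list" assume xy: "xs \<in> tuples n" "ys \<in> tuples n"
  show "(coords n xs = coords n ys) = (xs = ys)"
  proof
    assume eq: "coords n xs = coords n ys"
    have "coord (xs ! i) k = coord (ys ! i) k" if "i < n" "k < q" for i k
      using fun_cong[OF eq, of "(i, k)"] that by (simp add: coords_def idx_def)
    then have "xs ! i = ys ! i" if "i < n" for i
      using coord_ext that by blast
    then show "xs = ys"
      using xy by (auto simp: tuples_def intro: nth_equalityI)
  qed simp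
next
  fix xs :: "'m list" show "coords n xs \<in> idx n \<rightarrow>\<^sub>E V" by (rule coords_in)
next
  fix z assume z: "z \<in> idx n \<rightarrow>\<^sub>E V"
  \<comment> \<open>Each entry is assembled from its own \<open>q\<close> coordinates.\<close>
  define xs where "xs = map (\<lambda>i. \<Sum>k<q. z (i, k) \<star> unit_mat 0 k 1) [0..<n]"
  have "z = coords n xs"
  proof (rule PiE_ext[OF z coords_in])
    fix p assume "p \<in> idx n"
    moreover obtain i k where p: "p = (i, k)" by fastforce
    ultimately have ik: "i < n" "k < q" by (auto simp: idx_def)
    have "z (i, l) \<in> V" if "l < q" for l
      using z ik that by (auto simp: idx_def)
    then have "coord (xs ! i) k = z (i, k)"
      using ik by (simp add: xs_def coord_assemble)
    then show "z p = coords n xs p"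
      using ik by (simp add: p coords_def idx_def)
  qed
  moreover have "xs \<in> tuples n" by (simp add: tuples_def xs_def)
  ultimately show "\<exists>xs\<in>tuples n. z = coords n xs" by blast
qed

lemma coords_eq_iff:
  "xs \<in> tuples n \<Longrightarrow> ys \<in> tuples n \<Longrightarrow> coords n xs = coords n ys \<longleftrightarrow> xs = ys"
  using coords_bij_betw[of n] by (auto simp: bij_betw_def inj_on_eq_iff)

lemma coords_surj: "z \<in> idx n \<rightarrow>\<^sub>E V \<Longrightarrow> \<exists>xs\<in>tuples n. coords n xs = z"
  unfolding bij_betw_imp_surj_on[OF coords_bij_betw, symmetric] by blast

text \<open>By \<open>coord_star\<close>, each coordinate \<open>l\<close> of an expression over the
  matrix ring is one linear expression over \<open>R\<close>, with coefficients from the columns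
  \<open>l\<close> of the matrices.\<close>

lemma coord_lin_comb:
  assumes "length v = n" "length c = n" "set c \<subseteq> carrier_mat q q" "l < q"
  shows "coord (lin_comb act v c) l = (\<Sum>p\<in>idx n. coords n v p \<cdot> (c ! fst p $$ (snd p, l)))"
proof -
  have "coord (lin_comb act v c) l = (\<Sum>i<n. \<Sum>k<q. coord (v ! i) k \<cdot> (c ! i) $$ (k, l))"
    unfolding lin_comb_def coord_sum using assms
    by (intro sum.cong coord_star) (auto simp: subset_iff)
  also have "\<dots> = (\<Sum>p\<in>idx n. coord (v ! fst p) (snd p) \<cdot> (c ! fst p $$ (snd p, l)))"
    by (simp add: sum.cartesian_product idx_def case_prod_beta)
  also have "\<dots> = (\<Sum>p\<in>idx n. coords n v p \<cdot> (c ! fst p $$ (snd p, l)))"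
    by (intro sum.cong) (auto simp: coords_def)
  finally show ?thesis .
qed

lemma coords_append1: "length xs = n \<Longrightarrow> restrict (coords (n + m) (xs @ ys)) (idx n) = coords n xs"
  by (auto simp: coords_def idx_def nth_append fun_eq_iff restrict_def)

text \<open>Places the second factor of a concatenation behind the first \<open>n\<close> entries;
  it plays the role of \<open>h\<close> in \<open>affine_on_prod\<close>.\<close>

definition shift :: "nat \<Rightarrow> nat \<times> nat \<Rightarrow> nat \<times> nat" where
  "shift n p = (n + fst p, snd p)"

lemma inj_shift: "inj (shift n)"
  by (auto simp: shift_def inj_on_def prod_eq_iff)

lemma idx_add: "idx (n + m) = idx n \<union> shift n ` idx m"
proof -
  have "p \<in> shift n ` idx m" if "p \<in> idx (n + m)" "p \<notin> idx n" for p
    using that by (intro image_eqI[of _ _ "(fst p - n, snd p)"]) (auto simp: shift_def idx_def)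
  then show ?thesis by (auto simp: idx_def shift_def)
qed

lemma idx_shift_disjoint: "idx n \<inter> shift n ` idx m = {}"
  by (auto simp: idx_def shift_def)

lemma coords_append2:
  "length xs = n \<Longrightarrow> (\<lambda>p\<in>idx m. coords (n + m) (xs @ ys) (shift n p)) = coords m ys"
  by (auto simp: coords_def idx_def shift_def nth_append fun_eq_iff restrict_def)

section \<open>Non-empty pp-definable sets and affine sets\<close>

text \<open>Free variables, parameters and bound variables form one tuple of length
  \<open>N\<close>, constrained by linear equations over \<open>R\<close>. Quantification and the
  removal of the parameters are then a projection to the first \<open>n\<close> entries.\<close>

lemma pp_definable_imp_affine:
  assumes "pp_definable (ring_mat TYPE('r) q ()) act n X" "X \<noteq> {}"
  shows "X \<subseteq> tuples n \<and> (\<exists>I. affine_on (idx n) I (coords n ` X))"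
proof -
  from assms(1) obtain m \<phi> ps where ps: "length ps = m"
    and \<phi>: "pp_formula_in (ring_mat TYPE('r) q ()) (n + m) \<phi>"
    and X: "X = {xs \<in> tuples n. pp_holds act \<phi> (xs @ ps)}"
    by (auto simp: pp_definable_def tuples_def)
  define N where "N = n + m + bound_vars \<phi>"
  have c: "length c = N" "set c \<subseteq> carrier_mat q q" if "c \<in> set (equations \<phi>)" for c
    using \<phi> that by (auto simp: pp_formula_in_def N_def ring_mat_simps)
  \<comment> \<open>Each equation of the formula gives \<open>q\<close> equations over
    \<open>R\<close>, one per coordinate.\<close>
  define E1 where "E1 = (\<lambda>(c, l). (\<lambda>p. c ! fst p $$ (snd p, l), 0 :: 'm)) ` (set (equations \<phi>) \<times> {..<q})"
  \<comment> \<open>These equations force the entries \<open>n\<close> to \<open>n + m - 1\<close>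
    to be the parameters.\<close>
  define E2 where "E2 = (\<lambda>p. (\<lambda>p'. if p' = p then 1 else 0 :: 'r, coord (ps ! (fst p - n)) (snd p))) `
    ({n..<n + m} \<times> {..<q})"
  define Z where "Z = {z \<in> idx N \<rightarrow>\<^sub>E V. \<forall>(c, e)\<in>E1 \<union> E2. (\<Sum>p\<in>idx N. z p \<cdot> c p) = e}"
  have Z: "coords N zs \<in> Z \<longleftrightarrow>
      (\<forall>c\<in>set (equations \<phi>). lin_comb act zs c = 0) \<and> take m (drop n zs) = ps"
    if zs: "length zs = N" for zs
  proof -
    have "(\<forall>(c, e)\<in>E1. (\<Sum>p\<in>idx N. coords N zs p \<cdot> c p) = e) \<longleftrightarrow>
        (\<forall>c\<in>set (equations \<phi>). \<forall>l<q. (\<Sum>p\<in>idx N. coords N zs p \<cdot> (c ! fst p $$ (snd p, l))) = 0)"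
      by (auto simp: E1_def)
    also have "\<dots> \<longleftrightarrow> (\<forall>c\<in>set (equations \<phi>). \<forall>l<q. coord (lin_comb act zs c) l = 0)"
      using zs c by (simp add: coord_lin_comb)
    also have "\<dots> \<longleftrightarrow> (\<forall>c\<in>set (equations \<phi>). lin_comb act zs c = 0)"
      using coord_ext[of _ 0] by (auto)
    finally have 1: "(\<forall>(c, e)\<in>E1. (\<Sum>p\<in>idx N. coords N zs p \<cdot> c p) = e) \<longleftrightarrow>
        (\<forall>c\<in>set (equations \<phi>). lin_comb act zs c = 0)" .
    have pick: "(\<Sum>p'\<in>idx N. coords N zs p' \<cdot> (if p' = p then 1 else 0)) = coord (zs ! fst p) (snd p)"
      if "p \<in> {n..<n + m} \<times> {..<q}" for p
    proof -
      have p: "p \<in> idx N" using that by (auto simp: idx_def N_def)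
      have "(\<Sum>p'\<in>idx N. coords N zs p' \<cdot> (if p' = p then 1 else 0)) =
          (\<Sum>p'\<in>idx N. if p' = p then coords N zs p' \<cdot> 1 else 0)"
        by (intro sum.cong) auto
      then show ?thesis using p by (simp add: coords_apply sc_one)
    qed
    have "(\<forall>(c, e)\<in>E2. (\<Sum>p\<in>idx N. coords N zs p \<cdot> c p) = e) \<longleftrightarrow>
        (\<forall>p\<in>{n..<n + m} \<times> {..<q}. coord (zs ! fst p) (snd p) = coord (ps ! (fst p - n)) (snd p))"
      using pick by (simp add: E2_def)
    also have "\<dots> \<longleftrightarrow> (\<forall>i\<in>{n..<n + m}. zs ! i = ps ! (i - n))"
      by (auto intro: coord_ext)
    also have "\<dots> \<longleftrightarrow> (\<forall>i<m. zs ! (n + i) = ps ! i)"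
      by (auto dest: bspec[of _ _ "n + _"] simp: le_iff_add)
    also have "\<dots> \<longleftrightarrow> take m (drop n zs) = ps"
      using ps zs by (auto simp: list_eq_iff_nth_eq N_def)
    finally have 2: "(\<forall>(c, e)\<in>E2. (\<Sum>p\<in>idx N. coords N zs p \<cdot> c p) = e) \<longleftrightarrow> take m (drop n zs) = ps" .
    show ?thesis
      unfolding Z_def ball_Un mem_Collect_eq 1 2 using coords_in[of N zs] by simp
  qed
  have img: "coords n ` X = (\<lambda>z. restrict z (idx n)) ` Z"
  proof (intro equalityI subsetI)
    fix z assume "z \<in> coords n ` X"
    then obtain xs ys where xs: "length xs = n" "z = coords n xs" and ys: "length ys = bound_vars \<phi>"
      and eqs: "\<forall>c\<in>set (equations \<phi>). lin_comb act ((xs @ ps) @ ys) c = 0"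
      by (auto simp: X pp_holds_def tuples_def)
    let ?zs = "xs @ (ps @ ys)"
    have "coords N ?zs \<in> Z" using Z[of ?zs] xs ys ps eqs by (simp add: N_def)
    moreover have "z = restrict (coords N ?zs) (idx n)"
      using coords_append1[of xs n "m + bound_vars \<phi>"] xs by (simp add: N_def add.assoc)
    ultimately show "z \<in> (\<lambda>z. restrict z (idx n)) ` Z" by blast
  next
    fix z assume "z \<in> (\<lambda>z. restrict z (idx n)) ` Z"
    then obtain w where w: "w \<in> Z" "z = restrict w (idx n)" by blast
    then obtain zs where zs: "length zs = N" "w = coords N zs"
      using coords_surj[of w N] by (auto simp: Z_def tuples_def)
    define xs ys where "xs = take n zs" and "ys = drop (n + m) zs"
    have *: "take m (drop n zs) = ps" "\<forall>c\<in>set (equations \<phi>). lin_comb act zs c = 0"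
      using Z[of zs] w zs by auto
    have "zs = take n zs @ take m (drop n zs) @ drop m (drop n zs)"
      by (simp only: append_take_drop_id)
    then have split: "zs = xs @ (ps @ ys)"
      by (simp add: xs_def ys_def * add.commute)
    have len: "length xs = n" "length ys = bound_vars \<phi>"
      using zs by (auto simp: xs_def ys_def N_def)
    have "xs \<in> X"
      using len * split by (auto simp: X pp_holds_def tuples_def)
    moreover have "z = coords n xs"
      using coords_append1[of xs n "m + bound_vars \<phi>" "ps @ ys"] len
      by (simp add: w zs split N_def add.assoc)
    ultimately show "z \<in> coords n ` X" by blast
  qed
  then have "Z \<noteq> {}" using assms(2) by auto
  then have "\<exists>I. affine_on (idx N) I Z"
    unfolding Z_def
    by (intro affine_on_equations[OF _ affine_on_all[OF finite_idx]]) (auto simp: E1_def E2_def)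
  then have "\<exists>I. affine_on (idx n) I (coords n ` X)"
    unfolding img using affine_on_restrict idx_mono[of n N] by (auto simp: N_def)
  then show ?thesis by (auto simp: X)
qed

text \<open>
  Coefficient matrices supported on column \<open>0\<close>: an equation with such coefficients amounts to a
  single linear equation over \<open>R\<close> between the coordinates in \<open>V\<close>.
\<close>

definition first_column :: "nat \<Rightarrow> (nat \<times> nat \<Rightarrow> 'r) \<Rightarrow> 'r mat list" where
  "first_column n a = map (\<lambda>i. mat q q (\<lambda>(k, l). if l = 0 then a (i, k) else 0)) [0..<n]"

lemma length_first_column [simp]: "length (first_column n a) = n"
  by (simp add: first_column_def)

lemma coord_lin_comb_first_column:
  assumes "length v = n" "l < q"
  shows "coord (lin_comb act v (first_column n a)) l =
    (if l = 0 then \<Sum>p\<in>idx n. coords n v p \<cdot> a p else 0)"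
proof -
  have "coord (lin_comb act v (first_column n a)) l =
      (\<Sum>p\<in>idx n. coords n v p \<cdot> (first_column n a ! fst p $$ (snd p, l)))"
    using assms by (intro coord_lin_comb) (auto simp: first_column_def)
  also have "\<dots> = (\<Sum>p\<in>idx n. if l = 0 then coords n v p \<cdot> a p else 0)"
    using assms by (intro sum.cong) (auto simp: first_column_def idx_def)
  finally show ?thesis by simp
qed

lemma lin_comb_first_column_eq_0:
  assumes "length v = n" "length w = m"
  shows "lin_comb act (v @ w) (first_column n a @ first_column m b) = 0 \<longleftrightarrow>
    (\<Sum>p\<in>idx n. coords n v p \<cdot> a p) + (\<Sum>p\<in>idx m. coords m w p \<cdot> b p) = 0" (is "?x = 0 \<longleftrightarrow> ?s = 0")
proof -
  have x: "coord ?x l = (if l = 0 then ?s else 0)" if "l < q" for l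
    using assms that
    by (simp add: lin_comb_append coord_add coord_lin_comb_first_column)
  show ?thesis
  proof
    assume "?x = 0"
    then show "?s = 0" using x[OF q_pos] by simp
  next
    assume "?s = 0"
    then show "?x = 0" using x by (subst coord_ext[of _ 0]) simp_all
  qed
qed

lemma affine_imp_pp_definable:
  assumes "X \<subseteq> tuples n" "affine_on (idx n) I (coords n ` X)"
  shows "pp_definable (ring_mat TYPE('r) q ()) act n X"
proof -
  from assms(2) obtain A b where I: "I \<subseteq> idx n" and b: "b \<in> idx n \<rightarrow> V"
    and X: "coords n ` X = solved (idx n) I A b"
    by (auto simp: affine_on_def)
  \<comment> \<open>The parameter tuple is the one whose coordinates are \<open>b\<close>.\<close>
  obtain ps where ps: "ps \<in> tuples n" "coords n ps = restrict b (idx n)"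
    using coords_surj[of "restrict b (idx n)" n] b by auto
  obtain D where D: "set D = idx n - I"
    using finite_list[of "idx n - I"] by auto
  define a where "a j p = (if p \<in> I then - A p j else if p = j then 1 else 0)" for j p
  define a' :: "nat \<times> nat \<Rightarrow> nat \<times> nat \<Rightarrow> 'r" where "a' j p = (if p = j then - 1 else 0)" for j p
  define \<phi> where "\<phi> = PP 0 (map (\<lambda>j. first_column n (a j) @ first_column n (a' j)) D)"
  have eq: "lin_comb act (xs @ ps) (first_column n (a j) @ first_column n (a' j)) = 0 \<longleftrightarrow>
      coords n xs j = (\<Sum>i\<in>I. coords n xs i \<cdot> A i j) + b j"
    if xs: "length xs = n" and j: "j \<in> idx n - I" for xs j
  proof -
    let ?x = "coords n xs"
    have "(\<Sum>p\<in>idx n. ?x p \<cdot> a j p) = (\<Sum>p\<in>I. ?x p \<cdot> a j p) + (\<Sum>p\<in>idx n - I. ?x p \<cdot> a j p)"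
      using sum.subset_diff[OF I finite_idx] by (simp add: add.commute)
    also have "(\<Sum>p\<in>I. ?x p \<cdot> a j p) = - (\<Sum>p\<in>I. ?x p \<cdot> A p j)"
      by (simp add: a_def sc_minus_right sum_negf)
    also have "(\<Sum>p\<in>idx n - I. ?x p \<cdot> a j p) = (\<Sum>p\<in>idx n - I. if p = j then ?x p \<cdot> 1 else 0)"
      by (intro sum.cong) (auto simp: a_def)
    also have "\<dots> = ?x j"
      using j by (simp add: coords_apply sc_one)
    finally have 1: "(\<Sum>p\<in>idx n. ?x p \<cdot> a j p) = - (\<Sum>p\<in>I. ?x p \<cdot> A p j) + ?x j" .
    have "(\<Sum>p\<in>idx n. coords n ps p \<cdot> a' j p) = (\<Sum>p\<in>idx n. if p = j then - (b p \<cdot> 1) else 0)"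
      by (intro sum.cong) (auto simp: a'_def ps sc_minus_right)
    also have "\<dots> = - b j"
      using j b by (simp add: sc_one Pi_iff)
    finally have 2: "(\<Sum>p\<in>idx n. coords n ps p \<cdot> a' j p) = - b j" .
    have "length ps = n" using ps by (simp add: tuples_def)
    then show ?thesis
      unfolding lin_comb_first_column_eq_0[OF xs \<open>length ps = n\<close>] 1 2
      by (auto simp: algebra_simps)
  qed
  have X_eq: "X = {xs \<in> tuples n. pp_holds act \<phi> (xs @ ps)}"
  proof (rule Set.set_eqI)
    fix xs
    have "xs \<in> X \<longleftrightarrow> pp_holds act \<phi> (xs @ ps)" if xs: "xs \<in> tuples n"
    proof -
      have "xs \<in> X \<longleftrightarrow> coords n xs \<in> coords n ` X"
        using coords_eq_iff[OF xs] assms(1) by (auto simp: image_iff subset_iff)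
      also have "\<dots> \<longleftrightarrow> (\<forall>j\<in>idx n - I. coords n xs j = (\<Sum>i\<in>I. coords n xs i \<cdot> A i j) + b j)"
        using coords_in[of n xs] by (simp add: X solved_def)
      also have "\<dots> \<longleftrightarrow> pp_holds act \<phi> (xs @ ps)"
        using eq xs by (simp add: \<phi>_def pp_holds_def tuples_def D)
      finally show ?thesis .
    qed
    then show "xs \<in> X \<longleftrightarrow> xs \<in> {xs \<in> tuples n. pp_holds act \<phi> (xs @ ps)}"
      using assms(1) by auto
  qed
  have \<phi>_in: "pp_formula_in (ring_mat TYPE('r) q ()) (n + n) \<phi>"
    by (auto simp: pp_formula_in_def \<phi>_def first_column_def ring_mat_simps)
  show ?thesis
    unfolding pp_definable_def
    by (rule exI[of _ n], rule exI[of _ \<phi>], rule bexI[of _ ps], rule conjI[OF \<phi>_in X_eq], rule ps(1))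
qed

section \<open>Dimension of pp-definable sets\<close>

abbreviation MR :: "'r mat ring" where
  "MR \<equiv> ring_mat TYPE('r) q ()"

text \<open>A relation, since uniqueness of the dimension is proved only later, for non-zero
  \<open>V\<close>.\<close>

definition pp_dim :: "'m list set \<Rightarrow> nat \<Rightarrow> bool" where
  "pp_dim X d \<longleftrightarrow>
     (\<exists>n I. X \<subseteq> tuples n \<and> affine_on (idx n) I (coords n ` X) \<and> card I = d)"

lemma pp_dimE:
  assumes "pp_dim X d"
  obtains n I where "X \<subseteq> tuples n" "affine_on (idx n) I (coords n ` X)" "card I = d"
  using assms unfolding pp_dim_def by blast

lemma pp_sets_iff: "X \<in> pp_sets MR act \<longleftrightarrow> (\<exists>d. pp_dim X d)"
proof
  assume "X \<in> pp_sets MR act"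
  then show "\<exists>d. pp_dim X d"
    using pp_definable_imp_affine[of _ X] unfolding pp_sets_def pp_dim_def by blast
next
  assume "\<exists>d. pp_dim X d"
  then obtain n I where nI: "X \<subseteq> tuples n" "affine_on (idx n) I (coords n ` X)"
    unfolding pp_dim_def by blast
  show "X \<in> pp_sets MR act"
    using affine_imp_pp_definable[OF nI] affine_on_nonempty[OF nI(2)]
    unfolding pp_sets_def by blast
qed

lemma tuples_unique: "X \<noteq> {} \<Longrightarrow> X \<subseteq> tuples n \<Longrightarrow> X \<subseteq> tuples m \<Longrightarrow> n = m"
  by (auto simp: tuples_def)

lemma coords_bij_betw_image: "X \<subseteq> tuples n \<Longrightarrow> bij_betw (coords n) X (coords n ` X)"
  using coords_bij_betw[of n] by (auto simp: bij_betw_def intro: inj_on_subset)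

text \<open>The graph is itself affine and projects bijectively onto \<open>X\<close> and
  \<open>Y\<close>. Both projections copy coordinates, so all three sets have equally many free
  ones.\<close>

lemma pp_bijection_dim:
  assumes nz: "V \<noteq> {0}" and f: "pp_bijection MR act X Y f" and X: "pp_dim X d" and Y: "pp_dim Y e"
  shows "d = e"
proof -
  from X obtain n I where n: "X \<subseteq> tuples n" and I: "affine_on (idx n) I (coords n ` X)"
    and d: "card I = d" by (rule pp_dimE)
  from Y obtain m J where m: "Y \<subseteq> tuples m" and J: "affine_on (idx m) J (coords m ` Y)"
    and e: "card J = e" by (rule pp_dimE)
  have ne: "X \<noteq> {}" "Y \<noteq> {}" using affine_on_nonempty[OF I] affine_on_nonempty[OF J] by auto
  define G where "G = {xs @ f xs | xs. xs \<in> X}"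
  from f obtain n' m' where bij: "bij_betw f X Y" and
    "pp_definable MR act n' X" "pp_definable MR act m' Y" and G: "pp_definable MR act (n' + m') G"
    unfolding pp_bijection_def G_def by blast
  \<comment> \<open>The arities from \<open>pp_bijection\<close> agree with those from
    \<open>pp_dim\<close>, because a non-empty set of tuples determines their length.\<close>
  then have "X \<subseteq> tuples n'" "Y \<subseteq> tuples m'"
    using pp_definable_imp_affine ne by blast+
  then have [simp]: "n' = n" "m' = m"
    using tuples_unique n m ne by metis+
  have "G \<noteq> {}" using ne by (auto simp: G_def)
  then obtain K where K: "affine_on (idx (n + m)) K (coords (n + m) ` G)" and GT: "G \<subseteq> tuples (n + m)"
    using pp_definable_imp_affine[OF G] by auto
  have fY: "f xs \<in> Y" if "xs \<in> X" for xs using bij that by (auto simp: bij_betw_def)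
  have len: "length xs = n" "length (f xs) = m" if "xs \<in> X" for xs
    using that n m fY by (auto simp: tuples_def)
  have Gx: "coords (n + m) ` G = (\<lambda>xs. coords (n + m) (xs @ f xs)) ` X"
    by (auto simp: G_def)
  have "card K = card I"
  proof (rule affine_on_bij_card_eq[OF K I nz, where h = id])
    show "bij_betw (\<lambda>z. restrict z (idx n)) (coords (n + m) ` G) (coords n ` X)"
      unfolding Gx using coords_bij_betw_image[OF n] len
      by (intro bij_betw_image_factor) (auto simp: coords_append1 simp del: restrict_apply)
    show "id ` I \<subseteq> idx (n + m)"
      using I idx_mono[of n "n + m"] by (auto simp: affine_on_def)
    show "restrict x (idx n) j = x (id j)" if "j \<in> I" for x j
      using I that by (auto simp: affine_on_def)
  qed simp
  moreover have "card K = card J"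
  proof (rule affine_on_bij_card_eq[OF K J nz, where h = "shift n"])
    have "bij_betw (coords m \<circ> f) X (coords m ` Y)"
      using bij coords_bij_betw_image[OF m] by (rule bij_betw_trans)
    then show "bij_betw (\<lambda>z. \<lambda>p\<in>idx m. z (shift n p)) (coords (n + m) ` G) (coords m ` Y)"
      unfolding Gx
      by (rule bij_betw_image_factor) (simp add: len coords_append2 del: restrict_apply)
    show "inj_on (shift n) J" using inj_shift by (rule inj_on_subset) simp
    show "shift n ` J \<subseteq> idx (n + m)"
      using J idx_add[of n m] by (auto simp: affine_on_def)
    show "(\<lambda>p\<in>idx m. x (shift n p)) j = x (shift n j)" if "j \<in> J" for x j
      using J that by (auto simp: affine_on_def)
  qed
  ultimately show ?thesis using d e by simp
qed

text \<open>Brings the product into the form treated by \<open>affine_on_prod\<close>.\<close>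

lemma coords_tuple_prod:
  assumes "X \<subseteq> tuples n" "Y \<subseteq> tuples m"
  shows "coords (n + m) ` tuple_prod X Y =
    {z \<in> idx n \<union> shift n ` idx m \<rightarrow>\<^sub>E V. restrict z (idx n) \<in> coords n ` X \<and>
      (\<lambda>p\<in>idx m. z (shift n p)) \<in> coords m ` Y}" (is "_ = ?R")
proof (intro equalityI subsetI)
  fix z assume "z \<in> coords (n + m) ` tuple_prod X Y"
  then obtain xs ys where xy: "xs \<in> X" "ys \<in> Y" "z = coords (n + m) (xs @ ys)"
    by (auto simp: tuple_prod_def)
  then have "length xs = n" using assms by (auto simp: tuples_def)
  then show "z \<in> ?R"
    using xy coords_in[of "n + m" "xs @ ys"]
    by (auto simp: coords_append1 coords_append2 idx_add simp del: restrict_apply)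
next
  fix z assume z: "z \<in> ?R"
  then obtain zs where zs: "length zs = n + m" "coords (n + m) zs = z"
    using coords_surj[of z "n + m"] by (auto simp: idx_add tuples_def)
  define xs ys where "xs = take n zs" and "ys = drop n zs"
  have split: "zs = xs @ ys" and len: "length xs = n" "length ys = m"
    using zs by (auto simp: xs_def ys_def)
  have "coords n xs \<in> coords n ` X" "coords m ys \<in> coords m ` Y"
    using z len unfolding zs(2)[symmetric] split
    by (simp_all only: mem_Collect_eq coords_append1 coords_append2)
  then have "xs \<in> X" "ys \<in> Y"
    using inj_on_image_mem_iff[OF bij_betw_imp_inj_on[OF coords_bij_betw]] assms len
    by (simp_all add: tuples_def)
  then show "z \<in> coords (n + m) ` tuple_prod X Y"
    using zs split by (auto simp: tuple_prod_def)
qed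

lemma tuple_prod_tuples: "X \<subseteq> tuples n \<Longrightarrow> Y \<subseteq> tuples m \<Longrightarrow> tuple_prod X Y \<subseteq> tuples (n + m)"
  unfolding tuple_prod_def tuples_def by fastforce

lemma affine_on_tuple_prod:
  assumes "X \<subseteq> tuples n" "affine_on (idx n) I (coords n ` X)"
    and "Y \<subseteq> tuples m" "affine_on (idx m) J (coords m ` Y)"
  shows "affine_on (idx (n + m)) (I \<union> shift n ` J) (coords (n + m) ` tuple_prod X Y)"
  unfolding coords_tuple_prod[OF assms(1,3)] idx_add
  using assms inj_shift idx_shift_disjoint
  by (intro affine_on_prod) (auto intro: inj_on_subset)

lemma pp_dim_tuple_prod:
  assumes "pp_dim X d" "pp_dim Y e"
  shows "pp_dim (tuple_prod X Y) (d + e)"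
proof -
  from assms(1) obtain n I where n: "X \<subseteq> tuples n" and I: "affine_on (idx n) I (coords n ` X)"
    and d: "card I = d" by (rule pp_dimE)
  from assms(2) obtain m J where m: "Y \<subseteq> tuples m" and J: "affine_on (idx m) J (coords m ` Y)"
    and e: "card J = e" by (rule pp_dimE)
  have "I \<subseteq> idx n" "J \<subseteq> idx m" using I J by (auto simp: affine_on_def)
  then have "I \<inter> shift n ` J = {}" using idx_shift_disjoint by blast
  moreover have "finite I" "finite J" using I J affine_on_finite by blast+
  moreover have "card (shift n ` J) = card J"
    by (intro card_image inj_on_subset[OF inj_shift]) simp
  ultimately have "card (I \<union> shift n ` J) = d + e"
    using d e by (simp add: card_Un_disjoint)
  then show ?thesis
    using affine_on_tuple_prod[OF n I m J] tuple_prod_tuples[OF n m] unfolding pp_dim_def by blast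
qed

text \<open>Matching the free coordinates by a bijection \<open>t\<close> parametrises both sets by
  \<open>V\<close>-valued families on \<open>I\<close>. The graph is cut out of the product by the
  equations \<open>x i = y (t i)\<close>, so it is affine and hence pp-definable.\<close>

lemma pp_dim_bijection:
  assumes X: "pp_dim X d" and Y: "pp_dim Y d"
  shows "\<exists>f. pp_bijection MR act X Y f"
proof -
  from X obtain n I where n: "X \<subseteq> tuples n" and I: "affine_on (idx n) I (coords n ` X)"
    and cI: "card I = d" by (rule pp_dimE)
  from Y obtain m J where m: "Y \<subseteq> tuples m" and J: "affine_on (idx m) J (coords m ` Y)"
    and cJ: "card J = d" by (rule pp_dimE)
  have sub: "I \<subseteq> idx n" "J \<subseteq> idx m" using I J by (auto simp: affine_on_def)
  have fin: "finite I" "finite J" using I J affine_on_finite by blast+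
  obtain t where t: "bij_betw t I J"
    using finite_same_card_bij[OF fin] cI cJ by auto
  define \<alpha> where "\<alpha> xs = restrict (coords n xs) I" for xs
  \<comment> \<open>Reindexing along \<open>t\<close> gives \<open>\<alpha>\<close> and
    \<open>\<beta>\<close> the same target.\<close>
  define \<beta> where "\<beta> ys = (\<lambda>i\<in>I. coords m ys (t i))" for ys
  have \<alpha>: "bij_betw \<alpha> X (I \<rightarrow>\<^sub>E V)"
    using bij_betw_trans[OF coords_bij_betw_image[OF n] affine_on_bij_betw[OF I]]
    unfolding \<alpha>_def comp_def .
  have "bij_betw (\<lambda>w. \<lambda>i\<in>I. w (t i)) (J \<rightarrow>\<^sub>E V) (I \<rightarrow>\<^sub>E V)"
  proof (rule bij_betwI')
    fix w w' assume w: "w \<in> J \<rightarrow>\<^sub>E V" "w' \<in> J \<rightarrow>\<^sub>E V"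
    show "((\<lambda>i\<in>I. w (t i)) = (\<lambda>i\<in>I. w' (t i))) = (w = w')"
    proof
      assume "(\<lambda>i\<in>I. w (t i)) = (\<lambda>i\<in>I. w' (t i))"
      then have "w (t i) = w' (t i)" if "i \<in> I" for i
        using that by (rule restrict_eqD)
      then show "w = w'"
        using t by (intro PiE_ext[OF w]) (auto simp: bij_betw_def)
    qed simp
  next
    fix w assume "w \<in> J \<rightarrow>\<^sub>E V"
    then show "(\<lambda>i\<in>I. w (t i)) \<in> I \<rightarrow>\<^sub>E V"
      using t by (auto simp: bij_betw_def PiE_iff)
  next
    fix u assume u: "u \<in> I \<rightarrow>\<^sub>E V"
    define w where "w = (\<lambda>j\<in>J. u (inv_into I t j))"
    have inv: "inv_into I t (t i) = i" "t i \<in> J" if "i \<in> I" for i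
      using t that by (auto simp: bij_betw_def)
    have "inv_into I t j \<in> I" if "j \<in> J" for j
      using t that by (auto simp: bij_betw_def intro: inv_into_into)
    then have "w \<in> J \<rightarrow>\<^sub>E V" using u by (auto simp: w_def PiE_iff)
    moreover have "u = (\<lambda>i\<in>I. w (t i))"
      using u inv by (intro PiE_ext[of u I "\<lambda>_. V"]) (auto simp: w_def PiE_iff)
    ultimately show "\<exists>w\<in>J \<rightarrow>\<^sub>E V. u = (\<lambda>i\<in>I. w (t i))" by blast
  qed
  from bij_betw_trans[OF bij_betw_trans[OF coords_bij_betw_image[OF m] affine_on_bij_betw[OF J]] this]
  have \<beta>: "bij_betw \<beta> Y (I \<rightarrow>\<^sub>E V)"
  proof (rule bij_betw_cong[THEN iffD1, rotated])
    fix ys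
    show "((\<lambda>w. \<lambda>i\<in>I. w (t i)) \<circ> ((\<lambda>x. restrict x J) \<circ> coords m)) ys = \<beta> ys"
      using t by (auto simp: \<beta>_def bij_betw_def)
  qed
  define f where "f = inv_into Y \<beta> \<circ> \<alpha>"
  have f: "bij_betw f X Y"
    unfolding f_def using \<alpha> bij_betw_inv_into[OF \<beta>] by (rule bij_betw_trans)
  have graph: "f xs = ys \<longleftrightarrow> \<alpha> xs = \<beta> ys" if "xs \<in> X" "ys \<in> Y" for xs ys
  proof -
    have "\<alpha> xs \<in> \<beta> ` Y" using \<alpha> \<beta> that by (auto simp: bij_betw_def)
    then have "\<beta> (f xs) = \<alpha> xs" by (simp add: f_def f_inv_into_f)
    moreover have "f xs \<in> Y" using f that by (auto simp: bij_betw_def)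
    moreover have "inj_on \<beta> Y" using \<beta> by (simp add: bij_betw_def)
    ultimately show ?thesis using that by (metis inj_onD)
  qed
  define G where "G = {xs @ f xs | xs. xs \<in> X}"
  \<comment> \<open>The equation for \<open>i\<close> says that coordinate \<open>i\<close> of the
    first block equals coordinate \<open>t i\<close> of the second.\<close>
  define E where "E = (\<lambda>i. (\<lambda>p. if p = i then 1 else if p = shift n (t i) then - 1 else 0 :: 'r, 0 :: 'm)) ` I"
  let ?P = "coords (n + m) ` tuple_prod X Y"
  define Z where "Z = {z \<in> ?P. \<forall>(c, e)\<in>E. (\<Sum>p\<in>idx (n + m). z p \<cdot> c p) = e}"
  have Z: "coords (n + m) (xs @ ys) \<in> Z \<longleftrightarrow> ys = f xs" if xy: "xs \<in> X" "ys \<in> Y" for xs ys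
  proof -
    let ?z = "coords (n + m) (xs @ ys)"
    have len: "length xs = n" using that n by (auto simp: tuples_def)
    have "(\<Sum>p\<in>idx (n + m). ?z p \<cdot> (if p = i then 1 else if p = shift n (t i) then - 1 else 0)) =
        coords n xs i - coords m ys (t i)" if "i \<in> I" for i
    proof -
      have ti: "t i \<in> idx m" "i \<in> idx n" using t sub that by (auto simp: bij_betw_def)
      then have p: "i \<in> idx (n + m)" "shift n (t i) \<in> idx (n + m)" "i \<noteq> shift n (t i)"
        using idx_shift_disjoint[of n m] by (auto simp: idx_add)
      have zi: "?z i = coords n xs i"
        using ti fun_cong[OF coords_append1[OF len, of m ys], of i] by simp
      have zt: "?z (shift n (t i)) = coords m ys (t i)"
        using ti fun_cong[OF coords_append2[OF len, of m ys], of "t i"] by simp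
      have "(\<Sum>p\<in>idx (n + m). ?z p \<cdot> (if p = i then 1 else if p = shift n (t i) then - 1 else 0)) =
          (\<Sum>p\<in>idx (n + m). (if p = i then ?z p \<cdot> 1 else 0) +
            (if p = shift n (t i) then - (?z p \<cdot> 1) else 0))"
        using p by (intro sum.cong) (auto simp: sc_minus_right)
      also have "\<dots> = ?z i \<cdot> 1 - ?z (shift n (t i)) \<cdot> 1"
        using p by (simp add: sum.distrib)
      also have "\<dots> = coords n xs i - coords m ys (t i)"
        using ti by (simp add: zi zt sc_one coords_apply)
      finally show ?thesis .
    qed
    then have "(\<forall>(c, e)\<in>E. (\<Sum>p\<in>idx (n + m). ?z p \<cdot> c p) = e) \<longleftrightarrow>
        (\<forall>i\<in>I. coords n xs i = coords m ys (t i))"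
      by (simp add: E_def)
    also have "\<dots> \<longleftrightarrow> \<alpha> xs = \<beta> ys"
      by (auto simp: \<alpha>_def \<beta>_def intro: restrict_ext dest: restrict_eqD)
    also have "\<dots> \<longleftrightarrow> ys = f xs" using graph[OF xy] by auto
    finally have "(\<forall>(c, e)\<in>E. (\<Sum>p\<in>idx (n + m). ?z p \<cdot> c p) = e) \<longleftrightarrow> ys = f xs" .
    moreover have "?z \<in> ?P" using xy by (auto simp: tuple_prod_def)
    ultimately show ?thesis by (simp add: Z_def)
  qed
  have fY: "f xs \<in> Y" if "xs \<in> X" for xs using f that by (auto simp: bij_betw_def)
  have GZ: "coords (n + m) ` G = Z"
  proof (intro equalityI subsetI)
    fix z assume "z \<in> coords (n + m) ` G"
    then show "z \<in> Z" using Z fY by (auto simp: G_def)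
  next
    fix z assume z: "z \<in> Z"
    then obtain xs ys where "xs \<in> X" "ys \<in> Y" "z = coords (n + m) (xs @ ys)"
      by (auto simp: Z_def tuple_prod_def)
    then show "z \<in> coords (n + m) ` G" using Z z by (auto simp: G_def)
  qed
  have "X \<noteq> {}" using affine_on_nonempty[OF I] by auto
  then have "Z \<noteq> {}" by (auto simp: G_def simp flip: GZ)
  then have "\<exists>K. affine_on (idx (n + m)) K (coords (n + m) ` G)"
    unfolding GZ Z_def using fin
    by (intro affine_on_equations[OF _ affine_on_tuple_prod[OF n I m J]]) (auto simp: E_def)
  moreover have "G \<subseteq> tuples (n + m)"
    using n m fY by (force simp: G_def tuples_def)
  ultimately have "pp_definable MR act (n + m) G"
    using affine_imp_pp_definable by blast
  then show ?thesis
    using f affine_imp_pp_definable[OF n I] affine_imp_pp_definable[OF m J]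
    unfolding pp_bijection_def G_def by blast
qed

section \<open>Values of the dimension and the monoid of colours\<close>

text \<open>The witness is \<open>V^d\<close> inside \<open>M^d\<close>: coordinate \<open>0\<close>
  of each entry is free and the others are zero.\<close>

lemma ex_pp_dim: "\<exists>X. pp_dim X d"
proof -
  let ?Z = "solved (idx d) ({..<d} \<times> {0}) (\<lambda>_ _. 0) (\<lambda>_. 0)"
  define X where "X = {xs \<in> tuples d. coords d xs \<in> ?Z}"
  have "?Z \<subseteq> idx d \<rightarrow>\<^sub>E V" by (auto simp: solved_def)
  then have "coords d ` X = ?Z"
    using coords_surj[of _ d] by (fastforce simp: X_def)
  moreover have "affine_on (idx d) ({..<d} \<times> {0}) ?Z"
    using q_pos by (intro affine_on_solved) (auto simp: idx_def)
  moreover have "X \<subseteq> tuples d" by (auto simp: X_def)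
  moreover have "card ({..<d} \<times> {0 :: nat}) = d" by (simp add: card_cartesian_product)
  ultimately have "pp_dim X d"
    unfolding pp_dim_def by (intro exI[of _ d] exI[of _ "{..<d} \<times> {0}"]) simp
  then show ?thesis ..
qed

lemma pp_dim_singleton: "pp_dim (tuples 0) 0"
proof -
  have "idx 0 = {}" by (simp add: idx_def)
  then have "coords 0 ` tuples 0 = idx 0 \<rightarrow>\<^sub>E V"
    using coords_bij_betw[of 0] by (simp add: bij_betw_def)
  then have "affine_on (idx 0) {} (coords 0 ` tuples 0)"
    using affine_on_all[OF finite_idx, of 0] \<open>idx 0 = {}\<close> by simp
  then show ?thesis unfolding pp_dim_def by (intro exI[of _ 0] exI[of _ "{}"]) simp
qed

text \<open>Elements are determined by their coordinates in \<open>V\<close>, so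
  \<open>V = {0}\<close> would force the module to be zero.\<close>

lemma V_nontrivial:
  assumes "infinite (UNIV :: 'm set)"
  shows "V \<noteq> {0}"
proof
  assume "V = {0}"
  then have "coord x k = 0" for x k using coord_in_V by blast
  then have "x = 0" for x :: 'm by (intro coord_ext[of x 0]) simp
  then have "(UNIV :: 'm set) \<subseteq> {0}" by blast
  then have "finite (UNIV :: 'm set)" by (rule finite_subset) simp
  then show False using assms by simp
qed

text \<open>Some pp-definable bijection from \<open>X\<close> to itself exists, and such a bijection
  preserves dimension.\<close>

lemma pp_dim_unique:
  assumes "V \<noteq> {0}" "pp_dim X d" "pp_dim X e"
  shows "d = e"
  using pp_bijection_dim[OF assms(1) _ assms(2,3)] pp_dim_bijection[OF assms(2,2)] by blast

text \<open>Two sets have the same colour exactly when they have the same dimension, so the colours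
  are the level sets \<open>cls d\<close>, and \<open>cls\<close> turns addition into the
  product.\<close>

lemma colour_monoid_iso:
  assumes "infinite (UNIV :: 'm set)"
  shows "comm_monoid (colour_monoid MR act)"
    and "colour_monoid MR act \<cong> multiples_monoid q"
    and "colour_monoid MR act \<cong> nat_add_monoid"
proof -
  note nz = V_nontrivial[OF assms]
  define cls where "cls d = {X. pp_dim X d}" for d
  have rel: "(X, Y) \<in> colour_rel MR act \<longleftrightarrow> (\<exists>d. pp_dim X d \<and> pp_dim Y d)" for X Y
    unfolding colour_rel_def mem_Collect_eq case_prod_conv pp_sets_iff
    using pp_bijection_dim[OF nz] pp_dim_bijection by blast
  have Image: "colour_rel MR act `` {X} = cls d" if "pp_dim X d" for X d
  proof -
    have "(X, Y) \<in> colour_rel MR act \<longleftrightarrow> pp_dim Y d" for Y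
      unfolding rel using pp_dim_unique[OF nz that] that by blast
    then show ?thesis by (auto simp: cls_def)
  qed
  have carrier: "carrier (colour_monoid MR act) = range cls"
  proof (intro equalityI subsetI)
    fix A assume "A \<in> carrier (colour_monoid MR act)"
    then obtain X where "X \<in> pp_sets MR act" "A = colour_rel MR act `` {X}"
      by (auto simp: colour_monoid_def elim: quotientE)
    then show "A \<in> range cls" using Image pp_sets_iff by blast
  next
    fix A assume "A \<in> range cls"
    then obtain d where A: "A = cls d" by blast
    obtain X where X: "pp_dim X d" using ex_pp_dim by blast
    then show "A \<in> carrier (colour_monoid MR act)"
      using Image[OF X] quotientI[of X "pp_sets MR act" "colour_rel MR act"]
      by (auto simp: colour_monoid_def A pp_sets_iff)
  qed
  have "inj cls"
  proof (rule injI)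
    fix a b assume "cls a = cls b"
    moreover obtain X where "pp_dim X a" using ex_pp_dim by blast
    ultimately show "a = b" using pp_dim_unique[OF nz] unfolding cls_def by blast
  qed
  have mult: "cls a \<otimes>\<^bsub>colour_monoid MR act\<^esub> cls b = cls (a + b)" for a b
  proof -
    obtain X Y where XY: "pp_dim X a" "pp_dim Y b" using ex_pp_dim by blast
    \<comment> \<open>The product is a union of classes over all choices of representatives. Each
      product set has dimension \<open>a + b\<close>, so these classes coincide, and
      \<open>XY\<close> shows that there is at least one.\<close>
    have "cls a \<otimes>\<^bsub>colour_monoid MR act\<^esub> cls b =
        (\<Union>Z\<in>{tuple_prod X Y | X Y. pp_dim X a \<and> pp_dim Y b}. colour_rel MR act `` {Z})"
      by (auto simp: colour_monoid_def cls_def)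
    also have "\<dots> = (\<Union>Z\<in>{tuple_prod X Y | X Y. pp_dim X a \<and> pp_dim Y b}. cls (a + b))"
      by (intro SUP_cong refl) (blast intro!: Image pp_dim_tuple_prod)
    also have "\<dots> = cls (a + b)" using XY by auto
    finally show ?thesis .
  qed
  have one: "\<one>\<^bsub>colour_monoid MR act\<^esub> = cls 0"
    using Image[OF pp_dim_singleton] by (simp add: colour_monoid_def)
  have "q \<ge> 1" using q_pos by simp
  note monoid_isomorphic_to_nat[OF carrier \<open>inj cls\<close> mult one this]
  then show "comm_monoid (colour_monoid MR act)" "colour_monoid MR act \<cong> multiples_monoid q"
    "colour_monoid MR act \<cong> nat_add_monoid" .
qed

end

theorem theorem3p8:
  fixes act :: "'m :: ab_group_add \<Rightarrow> 'r :: division_ring mat \<Rightarrow> 'm"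
    and q :: nat
  assumes "q \<ge> 1"
    and "right_module (ring_mat TYPE('r) q ()) act"
    and "infinite (UNIV :: 'm set)"
  shows "comm_monoid (colour_monoid (ring_mat TYPE('r) q ()) act)
       \<and> colour_monoid (ring_mat TYPE('r) q ()) act \<cong> multiples_monoid q
       \<and> colour_monoid (ring_mat TYPE('r) q ()) act \<cong> nat_add_monoid"
proof -
  interpret matrix_module q act
    using assms by (intro matrix_module.intro matrix_module_axioms.intro) simp_all
  show ?thesis using colour_monoid_iso[OF assms(3)] by simp
qed

end
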